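(* Let $R$ be a ring. Every finitely generated completely virtually semisimple $R$-module is a direct sum of virtually simple modules. Up to a permutation, the virtually simple components in such a direct sum are uniquely determined up to isomorphism.
   Context: All rings are associative with identity and all modules are unitary. An $R$-module $M$ is virtually simple if $M\neq 0$ and $N\cong M$ for every nonzero submodule $N$ of $M$. An $R$-module $M$ is virtually semisimple if each submodule of $M$ is isomorphic to a direct summand of $M$, and completely virtually semisimple if each submodule of $M$ is a virtually semisimple module. The zero module is regarded as the empty direct sum. *)

theory Defs
  imports "HOL-Algebra.Module" "HOL-Algebra.AbelCoset"
begin

(* The locale module of HOL-Algebra requires a commutative ring of scalars.  The locale below is
   its exact analogue for unitary left modules over an arbitrary ring with identity. *)
locale left_module = R?: ring R + M?: abelian_group M
  for R (structure) and M (structure) +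
  assumes smult_closed [simp, intro]:
      "\<lbrakk>a \<in> carrier R; x \<in> carrier M\<rbrakk> \<Longrightarrow> a \<odot>\<^bsub>M\<^esub> x \<in> carrier M"
    and smult_l_distr:
      "\<lbrakk>a \<in> carrier R; b \<in> carrier R; x \<in> carrier M\<rbrakk> \<Longrightarrow>
        (a \<oplus> b) \<odot>\<^bsub>M\<^esub> x = a \<odot>\<^bsub>M\<^esub> x \<oplus>\<^bsub>M\<^esub> b \<odot>\<^bsub>M\<^esub> x"
    and smult_r_distr:
      "\<lbrakk>a \<in> carrier R; x \<in> carrier M; y \<in> carrier M\<rbrakk> \<Longrightarrow>
        a \<odot>\<^bsub>M\<^esub> (x \<oplus>\<^bsub>M\<^esub> y) = a \<odot>\<^bsub>M\<^esub> x \<oplus>\<^bsub>M\<^esub> a \<odot>\<^bsub>M\<^esub> y"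
    and smult_assoc1:
      "\<lbrakk>a \<in> carrier R; b \<in> carrier R; x \<in> carrier M\<rbrakk> \<Longrightarrow>
        (a \<otimes> b) \<odot>\<^bsub>M\<^esub> x = a \<odot>\<^bsub>M\<^esub> (b \<odot>\<^bsub>M\<^esub> x)"
    and smult_one [simp]:
      "x \<in> carrier M \<Longrightarrow> \<one> \<odot>\<^bsub>M\<^esub> x = x"

(* The library predicate submodule does not presuppose commutativity of the scalars.  A submodule N
   of M, viewed as a module, is the record M\<lparr>carrier := N\<rparr>. *)

definition module_isomorphic ::
    "('r, 'z) ring_scheme \<Rightarrow> ('r, 'm, 'x) module_scheme \<Rightarrow> ('r, 'n, 'y) module_scheme \<Rightarrow> bool"
  where "module_isomorphic R M N \<longleftrightarrow>
    (\<exists>h. bij_betw h (carrier M) (carrier N) \<and>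
      (\<forall>x\<in>carrier M. \<forall>y\<in>carrier M. h (x \<oplus>\<^bsub>M\<^esub> y) = h x \<oplus>\<^bsub>N\<^esub> h y) \<and>
      (\<forall>a\<in>carrier R. \<forall>x\<in>carrier M. h (a \<odot>\<^bsub>M\<^esub> x) = a \<odot>\<^bsub>N\<^esub> h x))"

definition direct_summand ::
    "('r, 'z) ring_scheme \<Rightarrow> ('r, 'm, 'x) module_scheme \<Rightarrow> 'm set \<Rightarrow> bool"
  where "direct_summand R M N \<longleftrightarrow> submodule N R M \<and>
    (\<exists>K. submodule K R M \<and> N <+>\<^bsub>M\<^esub> K = carrier M \<and> N \<inter> K = {\<zero>\<^bsub>M\<^esub>})"

definition finitely_generated_module ::
    "('r, 'z) ring_scheme \<Rightarrow> ('r, 'm, 'x) module_scheme \<Rightarrow> bool"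
  where "finitely_generated_module R M \<longleftrightarrow>
    (\<exists>S. finite S \<and> S \<subseteq> carrier M \<and> carrier M = \<Inter> {N. submodule N R M \<and> S \<subseteq> N})"

definition virtually_simple ::
    "('r, 'z) ring_scheme \<Rightarrow> ('r, 'm, 'x) module_scheme \<Rightarrow> bool"
  where "virtually_simple R M \<longleftrightarrow> carrier M \<noteq> {\<zero>\<^bsub>M\<^esub>} \<and>
    (\<forall>N. submodule N R M \<longrightarrow> N \<noteq> {\<zero>\<^bsub>M\<^esub>} \<longrightarrow> module_isomorphic R (M\<lparr>carrier := N\<rparr>) M)"

definition virtually_semisimple ::
    "('r, 'z) ring_scheme \<Rightarrow> ('r, 'm, 'x) module_scheme \<Rightarrow> bool"
  where "virtually_semisimple R M \<longleftrightarrow>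
    (\<forall>N. submodule N R M \<longrightarrow>
      (\<exists>K. direct_summand R M K \<and>
        module_isomorphic R (M\<lparr>carrier := N\<rparr>) (M\<lparr>carrier := K\<rparr>)))"

definition completely_virtually_semisimple ::
    "('r, 'z) ring_scheme \<Rightarrow> ('r, 'm, 'x) module_scheme \<Rightarrow> bool"
  where "completely_virtually_semisimple R M \<longleftrightarrow>
    (\<forall>N. submodule N R M \<longrightarrow> virtually_semisimple R (M\<lparr>carrier := N\<rparr>))"

(* M is the internal direct sum of the submodules V i, i \<in> I, where I may be infinite: each element
   of M is the sum of exactly one finitely supported family of elements of the V i.  (Families are
   extensional outside I, so that uniqueness refers to their values on I.)  For I = {} this says
   that M is the zero module. *)
definition internal_direct_sum ::
    "('r, 'z) ring_scheme \<Rightarrow> ('r, 'm, 'x) module_scheme \<Rightarrow> 'i set \<Rightarrow> ('i \<Rightarrow> 'm set) \<Rightarrow> bool"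
  where "internal_direct_sum R M I V \<longleftrightarrow>
    (\<forall>i\<in>I. submodule (V i) R M) \<and>
    (\<forall>x\<in>carrier M. \<exists>!f. f \<in> (\<Pi>\<^sub>E i\<in>I. V i) \<and> finite {i \<in> I. f i \<noteq> \<zero>\<^bsub>M\<^esub>} \<and>
      x = (\<Oplus>\<^bsub>M\<^esub>i\<in>{i \<in> I. f i \<noteq> \<zero>\<^bsub>M\<^esub>}. f i))"

end

theory Submission
  imports Defs
begin

text \<open>
  Every submodule is isomorphic to a direct summand, hence finitely generated, so \<open>M\<close> is Noetherian
  and splits into finitely many indecomposable summands. A nonzero submodule of an indecomposable
  summand is isomorphic to a nonzero direct summand of it, so the summands are virtually simple.

  For uniqueness, a virtually simple submodule of a Noetherian module is isomorphic to one of its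
  uniform submodules and therefore uniform itself. Uniform modules satisfy a Krull--Schmidt theorem
  up to nonzero submodules: if \<open>M\<close> is the direct sum of uniform modules \<open>V\<^sub>i\<close>, \<open>i \<in> I\<close>, with \<open>I\<close>
  finite, and the nonzero submodules \<open>W\<^sub>j\<close>, \<open>j \<in> J\<close>, are independent, then there is an injection
  \<open>\<pi> : J \<rightarrow> I\<close> such that \<open>W\<^sub>j\<close> and \<open>V\<^bsub>\<pi> j\<^esub>\<close> share a nonzero submodule up to isomorphism. For virtually
  simple modules sharing a nonzero submodule means being isomorphic, and injections in both
  directions between finite sets are bijections.
\<close>

section \<open>Submodules and homomorphisms\<close>

context left_module
begin

lemma smult_zero_left: "x \<in> carrier M \<Longrightarrow> \<zero> \<odot>\<^bsub>M\<^esub> x = \<zero>\<^bsub>M\<^esub>"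
  using smult_l_distr[of \<zero> \<zero> x] M.add.l_cancel_one'[of "\<zero> \<odot>\<^bsub>M\<^esub> x" "\<zero> \<odot>\<^bsub>M\<^esub> x"] by auto

lemma smult_zero_right: "a \<in> carrier R \<Longrightarrow> a \<odot>\<^bsub>M\<^esub> \<zero>\<^bsub>M\<^esub> = \<zero>\<^bsub>M\<^esub>"
  using smult_r_distr[of a "\<zero>\<^bsub>M\<^esub>" "\<zero>\<^bsub>M\<^esub>"]
    M.add.l_cancel_one'[of "a \<odot>\<^bsub>M\<^esub> \<zero>\<^bsub>M\<^esub>" "a \<odot>\<^bsub>M\<^esub> \<zero>\<^bsub>M\<^esub>"] by auto

lemma smult_minus_one: "x \<in> carrier M \<Longrightarrow> (\<ominus> \<one>) \<odot>\<^bsub>M\<^esub> x = \<ominus>\<^bsub>M\<^esub> x"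
  using smult_l_distr[of "\<ominus> \<one>" \<one> x] M.minus_equality[of "(\<ominus> \<one>) \<odot>\<^bsub>M\<^esub> x" x]
  by (simp add: smult_zero_left R.l_neg)

text \<open>Closure under negation follows from closure under scalars, since the negative of x is
  (-1) x.\<close>

lemma submoduleI:
  assumes "N \<subseteq> carrier M" "\<zero>\<^bsub>M\<^esub> \<in> N"
    and "\<And>x y. x \<in> N \<Longrightarrow> y \<in> N \<Longrightarrow> x \<oplus>\<^bsub>M\<^esub> y \<in> N"
    and smult: "\<And>a x. a \<in> carrier R \<Longrightarrow> x \<in> N \<Longrightarrow> a \<odot>\<^bsub>M\<^esub> x \<in> N"
  shows "submodule N R M"
proof -
  have "\<ominus>\<^bsub>M\<^esub> x \<in> N" if "x \<in> N" for x
    using smult[of "\<ominus> \<one>" x] that assms(1) by (auto simp: smult_minus_one)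
  then show ?thesis
    using assms by unfold_locales (auto simp: a_inv_def)
qed

lemma submoduleD:
  assumes "submodule N R M"
  shows "N \<subseteq> carrier M" "\<zero>\<^bsub>M\<^esub> \<in> N" "x \<in> N \<Longrightarrow> y \<in> N \<Longrightarrow> x \<oplus>\<^bsub>M\<^esub> y \<in> N"
    "a \<in> carrier R \<Longrightarrow> x \<in> N \<Longrightarrow> a \<odot>\<^bsub>M\<^esub> x \<in> N" "x \<in> N \<Longrightarrow> \<ominus>\<^bsub>M\<^esub> x \<in> N" "x \<in> N \<Longrightarrow> x \<in> carrier M"
  using assms unfolding submodule_def submodule_axioms_def subgroup_def by (auto simp: a_inv_def)

text \<open>Keeps all later arguments inside the fixed module \<open>M\<close>: the notions below
  are stated for subsets of its carrier, and this equivalence translates statements about a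
  submodule viewed as a module of its own.\<close>

lemma submodule_of_submodule:
  assumes "submodule N R M"
  shows "submodule K R (M\<lparr>carrier := N\<rparr>) \<longleftrightarrow> submodule K R M \<and> K \<subseteq> N"
proof
  assume K: "submodule K R (M\<lparr>carrier := N\<rparr>)"
  then have "K \<subseteq> N"
    unfolding submodule_def subgroup_def by simp
  moreover have "\<zero>\<^bsub>M\<^esub> \<in> K" "\<And>x y. x \<in> K \<Longrightarrow> y \<in> K \<Longrightarrow> x \<oplus>\<^bsub>M\<^esub> y \<in> K"
    "\<And>a x. a \<in> carrier R \<Longrightarrow> x \<in> K \<Longrightarrow> a \<odot>\<^bsub>M\<^esub> x \<in> K"
    using K unfolding submodule_def submodule_axioms_def subgroup_def by auto
  ultimately have "submodule K R M"
    using submoduleD(1)[OF assms] by (intro submoduleI) auto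
  with \<open>K \<subseteq> N\<close> show "submodule K R M \<and> K \<subseteq> N" by simp
next
  assume "submodule K R M \<and> K \<subseteq> N"
  then show "submodule K R (M\<lparr>carrier := N\<rparr>)"
    using M.add.subgroup_incl[of K N] assms
    unfolding submodule_def submodule_axioms_def by auto
qed

lemma submodule_carrier: "submodule (carrier M) R M"
  by (rule submoduleI) auto

lemma submodule_zero: "submodule {\<zero>\<^bsub>M\<^esub>} R M"
  by (rule submoduleI) (auto simp: smult_zero_right)

lemma submodule_Int:
  "submodule N R M \<Longrightarrow> submodule K R M \<Longrightarrow> submodule (N \<inter> K) R M"
  by (rule submoduleI) (auto simp: submoduleD)

lemma submodule_sum:
  assumes "submodule N R M" "submodule K R M"
  shows "submodule (N <+>\<^bsub>M\<^esub> K) R M"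
proof (rule submoduleI)
  show "N <+>\<^bsub>M\<^esub> K \<subseteq> carrier M"
    using assms by (auto simp: set_add_def' submoduleD)
  show "\<zero>\<^bsub>M\<^esub> \<in> N <+>\<^bsub>M\<^esub> K"
    using assms submoduleD(2) M.l_zero M.zero_closed unfolding set_add_def' by force
next
  fix x y assume "x \<in> N <+>\<^bsub>M\<^esub> K" "y \<in> N <+>\<^bsub>M\<^esub> K"
  then obtain n k n' k' where *: "n \<in> N" "k \<in> K" "n' \<in> N" "k' \<in> K"
      and eq: "x = n \<oplus>\<^bsub>M\<^esub> k" "y = n' \<oplus>\<^bsub>M\<^esub> k'"
    unfolding set_add_def' by auto
  have "x \<oplus>\<^bsub>M\<^esub> y = (n \<oplus>\<^bsub>M\<^esub> n') \<oplus>\<^bsub>M\<^esub> (k \<oplus>\<^bsub>M\<^esub> k')"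
    unfolding eq using * assms by (simp add: M.a_ac submoduleD)
  then show "x \<oplus>\<^bsub>M\<^esub> y \<in> N <+>\<^bsub>M\<^esub> K"
    using * assms submoduleD(3) unfolding set_add_def' by blast
next
  fix a x assume a: "a \<in> carrier R" and "x \<in> N <+>\<^bsub>M\<^esub> K"
  then obtain n k where *: "n \<in> N" "k \<in> K" and eq: "x = n \<oplus>\<^bsub>M\<^esub> k"
    unfolding set_add_def' by auto
  have "a \<odot>\<^bsub>M\<^esub> x = a \<odot>\<^bsub>M\<^esub> n \<oplus>\<^bsub>M\<^esub> a \<odot>\<^bsub>M\<^esub> k"
    unfolding eq using * a assms by (simp add: smult_r_distr submoduleD)
  then show "a \<odot>\<^bsub>M\<^esub> x \<in> N <+>\<^bsub>M\<^esub> K"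
    using * a assms submoduleD(4) unfolding set_add_def' by blast
qed

lemma in_sumE:
  assumes "x \<in> N <+>\<^bsub>M\<^esub> K"
  obtains n k where "n \<in> N" "k \<in> K" "x = n \<oplus>\<^bsub>M\<^esub> k"
  using assms unfolding set_add_def' by auto

lemma in_sumI: "n \<in> N \<Longrightarrow> k \<in> K \<Longrightarrow> n \<oplus>\<^bsub>M\<^esub> k \<in> N <+>\<^bsub>M\<^esub> K"
  unfolding set_add_def' by auto

lemma subset_sum_left:
  assumes "submodule N R M" "submodule K R M"
  shows "N \<subseteq> N <+>\<^bsub>M\<^esub> K"
proof
  fix x assume "x \<in> N"
  then show "x \<in> N <+>\<^bsub>M\<^esub> K"
    using in_sumI[of x N "\<zero>\<^bsub>M\<^esub>" K] submoduleD(6)[OF assms(1)] submoduleD(2)[OF assms(2)] by simp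
qed

lemma subset_sum_right:
  assumes "submodule N R M" "submodule K R M"
  shows "K \<subseteq> N <+>\<^bsub>M\<^esub> K"
proof
  fix x assume "x \<in> K"
  then show "x \<in> N <+>\<^bsub>M\<^esub> K"
    using in_sumI[of "\<zero>\<^bsub>M\<^esub>" N x K] submoduleD(6)[OF assms(2)] submoduleD(2)[OF assms(1)] by simp
qed

lemma sum_carrier_update: "N <+>\<^bsub>M\<lparr>carrier := L\<rparr>\<^esub> K = N <+>\<^bsub>M\<^esub> K"
  unfolding set_add_def' by simp

lemma sum_subset:
  assumes "submodule L R M" "N \<subseteq> L" "K \<subseteq> L"
  shows "N <+>\<^bsub>M\<^esub> K \<subseteq> L"
  using assms submoduleD(3) unfolding set_add_def' by blast

lemma sum_assoc:
  assumes "submodule N R M" "submodule K R M" "submodule L R M"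
  shows "(N <+>\<^bsub>M\<^esub> K) <+>\<^bsub>M\<^esub> L = N <+>\<^bsub>M\<^esub> (K <+>\<^bsub>M\<^esub> L)"
  using M.add.set_mult_assoc[of N K L] assms submoduleD(1) unfolding set_add_def by auto

lemma submodule_cancel_left:
  assumes "submodule N R M" "x \<in> N" "x \<oplus>\<^bsub>M\<^esub> y \<in> N" "y \<in> carrier M"
  shows "y \<in> N"
proof -
  have "y = \<ominus>\<^bsub>M\<^esub> x \<oplus>\<^bsub>M\<^esub> (x \<oplus>\<^bsub>M\<^esub> y)"
    using assms M.r_neg1 submoduleD(6) by simp
  then show ?thesis
    using assms submoduleD by metis
qed

lemma submodule_cancel_right:
  assumes "submodule N R M" "y \<in> N" "x \<oplus>\<^bsub>M\<^esub> y \<in> N" "x \<in> carrier M"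
  shows "x \<in> N"
  using submodule_cancel_left[of N y x] assms M.a_comm submoduleD(6) by metis

text \<open>The difference n - n' = k' - k lies in both \<open>N\<close> and \<open>K\<close>, hence
  vanishes.\<close>

lemma disjoint_unique:
  assumes "submodule N R M" "submodule K R M" "N \<inter> K = {\<zero>\<^bsub>M\<^esub>}"
    and "n \<in> N" "k \<in> K" "n' \<in> N" "k' \<in> K" "n \<oplus>\<^bsub>M\<^esub> k = n' \<oplus>\<^bsub>M\<^esub> k'"
  shows "n = n'" "k = k'"
proof -
  note c = submoduleD(6)[OF assms(1)] submoduleD(6)[OF assms(2)]
  have "\<ominus>\<^bsub>M\<^esub> n' \<oplus>\<^bsub>M\<^esub> n \<oplus>\<^bsub>M\<^esub> k = k'"
    using assms c by (simp add: M.a_assoc M.r_neg1)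
  then have "\<ominus>\<^bsub>M\<^esub> n' \<oplus>\<^bsub>M\<^esub> n \<in> K"
    using submodule_cancel_right[OF assms(2), of k "\<ominus>\<^bsub>M\<^esub> n' \<oplus>\<^bsub>M\<^esub> n"] assms c by simp
  moreover have "\<ominus>\<^bsub>M\<^esub> n' \<oplus>\<^bsub>M\<^esub> n \<in> N"
    using assms submoduleD by meson
  ultimately have "\<ominus>\<^bsub>M\<^esub> n' \<oplus>\<^bsub>M\<^esub> n = \<zero>\<^bsub>M\<^esub>"
    using assms(3) by blast
  then show "n = n'"
    using M.r_neg1[of n' n] M.r_neg2[of n' n] assms c by simp
  then show "k = k'"
    using assms c by simp
qed

text \<open>Functions are total, so both conditions are restricted to the domain \<open>N\<close>.
  The codomain is left open and imposed separately, by bijectivity in \<open>isomorphic\<close> and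
  by a function space in \<open>embedding\<close>.\<close>

definition linear :: "'c set \<Rightarrow> ('c \<Rightarrow> 'c) \<Rightarrow> bool"
  where "linear N h \<longleftrightarrow>
    (\<forall>x\<in>N. \<forall>y\<in>N. h (x \<oplus>\<^bsub>M\<^esub> y) = h x \<oplus>\<^bsub>M\<^esub> h y) \<and>
    (\<forall>a\<in>carrier R. \<forall>x\<in>N. h (a \<odot>\<^bsub>M\<^esub> x) = a \<odot>\<^bsub>M\<^esub> h x)"

definition isomorphic :: "'c set \<Rightarrow> 'c set \<Rightarrow> bool"
  where "isomorphic N K \<longleftrightarrow> (\<exists>h. bij_betw h N K \<and> linear N h)"

definition embedding :: "('c \<Rightarrow> 'c) \<Rightarrow> 'c set \<Rightarrow> 'c set \<Rightarrow> bool"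
  where "embedding h N K \<longleftrightarrow> h \<in> N \<rightarrow> K \<and> inj_on h N \<and> linear N h"

lemma module_isomorphic_iff:
  "module_isomorphic R (M\<lparr>carrier := N\<rparr>) (M\<lparr>carrier := K\<rparr>) \<longleftrightarrow> isomorphic N K"
  unfolding module_isomorphic_def isomorphic_def linear_def by simp

lemma linear_subset: "linear N h \<Longrightarrow> K \<subseteq> N \<Longrightarrow> linear K h"
  unfolding linear_def by blast

lemma linear_zero:
  assumes "submodule N R M" "linear N h" "h \<in> N \<rightarrow> carrier M"
  shows "h \<zero>\<^bsub>M\<^esub> = \<zero>\<^bsub>M\<^esub>"
proof -
  have z: "\<zero>\<^bsub>M\<^esub> \<in> N" "h \<zero>\<^bsub>M\<^esub> \<in> carrier M"
    using submoduleD(2)[OF assms(1)] assms(3) by auto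
  then have "h (\<zero> \<odot>\<^bsub>M\<^esub> \<zero>\<^bsub>M\<^esub>) = \<zero> \<odot>\<^bsub>M\<^esub> h \<zero>\<^bsub>M\<^esub>"
    using assms(2) unfolding linear_def by blast
  then show ?thesis
    using z by (simp add: smult_zero_left)
qed

lemma linear_image_submodule:
  assumes "submodule N R M" "linear N h" "h \<in> N \<rightarrow> carrier M"
  shows "submodule (h ` N) R M"
proof (rule submoduleI)
  show "h ` N \<subseteq> carrier M" using assms(3) by auto
  show "\<zero>\<^bsub>M\<^esub> \<in> h ` N" using linear_zero[OF assms] submoduleD(2)[OF assms(1)] by (metis imageI)
next
  fix x y assume "x \<in> h ` N" "y \<in> h ` N"
  then obtain u v where uv: "u \<in> N" "v \<in> N" "x = h u" "y = h v" by blast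
  then have "x \<oplus>\<^bsub>M\<^esub> y = h (u \<oplus>\<^bsub>M\<^esub> v)"
    using assms(2) unfolding linear_def by simp
  with uv show "x \<oplus>\<^bsub>M\<^esub> y \<in> h ` N"
    using submoduleD(3)[OF assms(1)] by blast
next
  fix a x assume a: "a \<in> carrier R" and "x \<in> h ` N"
  then obtain u where u: "u \<in> N" "x = h u" by blast
  then have "a \<odot>\<^bsub>M\<^esub> x = h (a \<odot>\<^bsub>M\<^esub> u)"
    using assms(2) a unfolding linear_def by simp
  with u a show "a \<odot>\<^bsub>M\<^esub> x \<in> h ` N"
    using submoduleD(4)[OF assms(1)] by blast
qed

lemma linear_vimage_submodule:
  assumes "submodule N R M" "linear N h" "h \<in> N \<rightarrow> carrier M" "submodule K R M"
  shows "submodule {x \<in> N. h x \<in> K} R M"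
proof (rule submoduleI)
  show "{x \<in> N. h x \<in> K} \<subseteq> carrier M"
    using submoduleD(1)[OF assms(1)] by blast
  show "\<zero>\<^bsub>M\<^esub> \<in> {x \<in> N. h x \<in> K}"
    using linear_zero[OF assms(1-3)] submoduleD(2)[OF assms(1)] submoduleD(2)[OF assms(4)] by simp
qed (use assms(2) submoduleD(3,4)[OF assms(1)] submoduleD(3,4)[OF assms(4)] in
    \<open>auto simp: linear_def\<close>)

lemma linear_comp:
  assumes "linear N h" "h \<in> N \<rightarrow> K" "linear K g"
  shows "linear N (g \<circ> h)"
  using assms unfolding linear_def Pi_def by auto

text \<open>Closure of \<open>N\<close> under the operations lets \<open>inv_into N h\<close> cancel
  \<open>h\<close> on sums and scalar multiples, which is linearity of the inverse.\<close>

lemma isomorphic_sym: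
  assumes "submodule N R M" "isomorphic N K"
  shows "isomorphic K N"
proof -
  obtain h where h: "bij_betw h N K" "linear N h"
    using assms(2) unfolding isomorphic_def by blast
  have img: "K = h ` N" and inj: "inj_on h N"
    using h(1) unfolding bij_betw_def by auto
  have "linear K (inv_into N h)"
    unfolding linear_def img
  proof (intro conjI ballI; clarify)
    fix x y assume xy: "x \<in> N" "y \<in> N"
    then have "h x \<oplus>\<^bsub>M\<^esub> h y = h (x \<oplus>\<^bsub>M\<^esub> y)"
      using h(2) unfolding linear_def by simp
    with xy show "inv_into N h (h x \<oplus>\<^bsub>M\<^esub> h y) = inv_into N h (h x) \<oplus>\<^bsub>M\<^esub> inv_into N h (h y)"
      using submoduleD(3)[OF assms(1)] inj by (simp add: inv_into_f_f)
  next
    fix a x assume ax: "a \<in> carrier R" "x \<in> N"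
    then have "a \<odot>\<^bsub>M\<^esub> h x = h (a \<odot>\<^bsub>M\<^esub> x)"
      using h(2) unfolding linear_def by simp
    with ax show "inv_into N h (a \<odot>\<^bsub>M\<^esub> h x) = a \<odot>\<^bsub>M\<^esub> inv_into N h (h x)"
      using submoduleD(4)[OF assms(1)] inj by (simp add: inv_into_f_f)
  qed
  then show ?thesis
    unfolding isomorphic_def using bij_betw_inv_into[OF h(1)] by blast
qed

lemma isomorphic_trans: "isomorphic N K \<Longrightarrow> isomorphic K L \<Longrightarrow> isomorphic N L"
proof -
  assume "isomorphic N K" "isomorphic K L"
  then obtain h g where "bij_betw h N K" "linear N h" "bij_betw g K L" "linear K g"
    unfolding isomorphic_def by blast
  then have "bij_betw (g \<circ> h) N L" "linear N (g \<circ> h)"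
    using bij_betw_trans linear_comp[of N h K g] bij_betw_imp_funcset by blast+
  then show ?thesis unfolding isomorphic_def by blast
qed

lemma isomorphic_zero_iff:
  assumes "submodule N R M" "submodule K R M" "isomorphic N K"
  shows "N = {\<zero>\<^bsub>M\<^esub>} \<longleftrightarrow> K = {\<zero>\<^bsub>M\<^esub>}"
proof -
  have "K = {\<zero>\<^bsub>M\<^esub>}" if "N = {\<zero>\<^bsub>M\<^esub>}" "isomorphic N K" "submodule K R M" for N K
    using that submoduleD(2)[of K] unfolding isomorphic_def bij_betw_def by auto
  then show ?thesis using assms isomorphic_sym by blast
qed

lemma embedding_image:
  assumes "submodule N R M" "submodule K R M" "embedding h N K"
  shows "submodule (h ` N) R M" "h ` N \<subseteq> K" "isomorphic N (h ` N)"
  using assms linear_image_submodule[of N h] submoduleD(1)[OF assms(2)]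
  unfolding embedding_def isomorphic_def bij_betw_def by (auto simp: Pi_def subset_iff)

lemma sum_comm:
  assumes "submodule N R M" "submodule K R M"
  shows "N <+>\<^bsub>M\<^esub> K = K <+>\<^bsub>M\<^esub> N"
proof -
  have "N <+>\<^bsub>M\<^esub> K \<subseteq> K <+>\<^bsub>M\<^esub> N" if "submodule N R M" "submodule K R M" for N K
  proof
    fix x assume "x \<in> N <+>\<^bsub>M\<^esub> K"
    then obtain n k where "n \<in> N" "k \<in> K" "x = n \<oplus>\<^bsub>M\<^esub> k" by (rule in_sumE)
    then show "x \<in> K <+>\<^bsub>M\<^esub> N"
      using in_sumI[of k K n N] M.a_comm submoduleD(6)[OF that(1)] submoduleD(6)[OF that(2)] by simp
  qed
  with assms show ?thesis by blast
qed

lemma sum_zero_right: "submodule N R M \<Longrightarrow> N <+>\<^bsub>M\<^esub> {\<zero>\<^bsub>M\<^esub>} = N"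
  unfolding set_add_def' using submoduleD(6) by force

lemma submodule_nonzeroE:
  assumes "submodule N R M" "N \<noteq> {\<zero>\<^bsub>M\<^esub>}"
  obtains x where "x \<in> N" "x \<noteq> \<zero>\<^bsub>M\<^esub>"
  using assms submoduleD(2)[OF assms(1)] by blast

lemma disjointI:
  assumes "submodule N R M" "submodule K R M" "\<And>x. x \<in> N \<Longrightarrow> x \<in> K \<Longrightarrow> x = \<zero>\<^bsub>M\<^esub>"
  shows "N \<inter> K = {\<zero>\<^bsub>M\<^esub>}"
  using assms(3) submoduleD(2)[OF assms(1)] submoduleD(2)[OF assms(2)] by blast

text \<open>Re-bracketing of a direct sum of three submodules. If n + c = 0 + x with x in
  \<open>D\<close>, then c and x both lie in C + D, so c = x by directness of N and C + D; hence x
  lies in C \<inter> D.\<close>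

lemma disjoint_sum:
  assumes "submodule N R M" "submodule C R M" "submodule D R M"
    and "N \<inter> (C <+>\<^bsub>M\<^esub> D) = {\<zero>\<^bsub>M\<^esub>}" "C \<inter> D = {\<zero>\<^bsub>M\<^esub>}"
  shows "(N <+>\<^bsub>M\<^esub> C) \<inter> D = {\<zero>\<^bsub>M\<^esub>}"
proof (rule disjointI[OF submodule_sum[OF assms(1,2)] assms(3)])
  fix x assume x: "x \<in> N <+>\<^bsub>M\<^esub> C" "x \<in> D"
  obtain n c where nc: "n \<in> N" "c \<in> C" "x = n \<oplus>\<^bsub>M\<^esub> c" using x(1) by (rule in_sumE)
  have cD: "c \<in> C <+>\<^bsub>M\<^esub> D" "x \<in> C <+>\<^bsub>M\<^esub> D"
    using subsetD[OF subset_sum_left[OF assms(2,3)] nc(2)]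
      subsetD[OF subset_sum_right[OF assms(2,3)] x(2)] by simp_all
  have "n \<oplus>\<^bsub>M\<^esub> c = \<zero>\<^bsub>M\<^esub> \<oplus>\<^bsub>M\<^esub> x"
    using nc submoduleD(6)[OF assms(3) x(2)] by simp
  then have "c = x"
    by (rule disjoint_unique(2)[OF assms(1) submodule_sum[OF assms(2,3)] assms(4) nc(1) cD(1)
        submoduleD(2)[OF assms(1)] cD(2)])
  then have "x \<in> C \<inter> D" using nc(2) x(2) by simp
  then show "x = \<zero>\<^bsub>M\<^esub>" using assms(5) by simp
qed

section \<open>Noetherian modules\<close>

text \<open>Avoids forming a span: for a submodule \<open>N\<close> the condition says that
  \<open>N\<close> is the least submodule containing \<open>S\<close>.\<close>

definition finitely_generated :: "'c set \<Rightarrow> bool"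
  where "finitely_generated N \<longleftrightarrow> (\<exists>S. finite S \<and> S \<subseteq> N \<and> (\<forall>P. submodule P R M \<longrightarrow> S \<subseteq> P \<longrightarrow> N \<subseteq> P))"

text \<open>The maximum condition is chosen over the ascending chain condition because each later
  use picks a maximal member of a set of submodules.\<close>

definition noetherian :: bool
  where "noetherian \<longleftrightarrow> (\<forall>F. F \<noteq> {} \<longrightarrow> (\<forall>N\<in>F. submodule N R M) \<longrightarrow>
    (\<exists>N\<in>F. \<forall>K\<in>F. N \<subseteq> K \<longrightarrow> K = N))"

lemma finitely_generated_module_imp_fg: "finitely_generated_module R M \<Longrightarrow> finitely_generated (carrier M)"
  unfolding finitely_generated_module_def finitely_generated_def by blast

text \<open>The components in \<open>N\<close> of finitely many generators of \<open>M\<close>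
  generate \<open>N\<close>. If a submodule \<open>P\<close> contains them, then (P \<inter> N) + K
  contains all generators and so equals \<open>M\<close>; by directness an element of
  \<open>N\<close> is its own component in P \<inter> N.\<close>

lemma finitely_generated_complemented:
  assumes "finitely_generated (carrier M)" "submodule N R M" "submodule K R M"
    and sum: "N <+>\<^bsub>M\<^esub> K = carrier M" and disj: "N \<inter> K = {\<zero>\<^bsub>M\<^esub>}"
  shows "finitely_generated N"
proof -
  obtain S where S: "finite S" "S \<subseteq> carrier M"
      "\<And>P. submodule P R M \<Longrightarrow> S \<subseteq> P \<Longrightarrow> carrier M \<subseteq> P"
    using assms(1) unfolding finitely_generated_def by blast
  have "\<exists>n. n \<in> N \<and> (\<exists>k\<in>K. s = n \<oplus>\<^bsub>M\<^esub> k)" if "s \<in> S" for s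
  proof -
    have "s \<in> N <+>\<^bsub>M\<^esub> K" using S(2) sum that by auto
    then show ?thesis by (rule in_sumE) blast
  qed
  then obtain p where p: "\<And>s. s \<in> S \<Longrightarrow> p s \<in> N \<and> (\<exists>k\<in>K. s = p s \<oplus>\<^bsub>M\<^esub> k)" by metis
  have "N \<subseteq> P" if P: "submodule P R M" "p ` S \<subseteq> P" for P
  proof
    fix x assume x: "x \<in> N"
    have PN: "submodule (P \<inter> N) R M" by (rule submodule_Int[OF P(1) assms(2)])
    have "S \<subseteq> (P \<inter> N) <+>\<^bsub>M\<^esub> K"
    proof
      fix s assume s: "s \<in> S"
      then obtain k where "k \<in> K" "s = p s \<oplus>\<^bsub>M\<^esub> k" using p by blast
      then show "s \<in> (P \<inter> N) <+>\<^bsub>M\<^esub> K"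
        using in_sumI[of "p s" "P \<inter> N" k K] s p P(2) by auto
    qed
    then have "carrier M \<subseteq> (P \<inter> N) <+>\<^bsub>M\<^esub> K"
      by (rule S(3)[OF submodule_sum[OF PN assms(3)]])
    then have "x \<in> (P \<inter> N) <+>\<^bsub>M\<^esub> K"
      using submoduleD(6)[OF assms(2) x] by (rule subsetD)
    then obtain n k where nk: "n \<in> P \<inter> N" "k \<in> K" "x = n \<oplus>\<^bsub>M\<^esub> k"
      by (rule in_sumE)
    have "n \<oplus>\<^bsub>M\<^esub> k = x \<oplus>\<^bsub>M\<^esub> \<zero>\<^bsub>M\<^esub>"
      using nk(3) x submoduleD(6)[OF assms(2)] by simp
    then have "n = x"
      by (rule disjoint_unique(1)[OF assms(2,3) disj IntD2[OF nk(1)] nk(2) x submoduleD(2)[OF assms(3)]])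
    then show "x \<in> P" using nk(1) by simp
  qed
  then show ?thesis
    unfolding finitely_generated_def using S(1) p by (intro exI[of _ "p ` S"]) auto
qed

lemma finitely_generated_isomorphic:
  assumes "finitely_generated N" "submodule N R M" "submodule K R M" "isomorphic N K"
  shows "finitely_generated K"
proof -
  obtain S where S: "finite S" "S \<subseteq> N" "\<And>P. submodule P R M \<Longrightarrow> S \<subseteq> P \<Longrightarrow> N \<subseteq> P"
    using assms(1) unfolding finitely_generated_def by blast
  obtain h where h: "h ` N = K" "linear N h"
    using assms(4) unfolding isomorphic_def bij_betw_def by blast
  have hc: "h \<in> N \<rightarrow> carrier M" using h(1) submoduleD(1)[OF assms(3)] by blast
  have "K \<subseteq> P" if P: "submodule P R M" "h ` S \<subseteq> P" for P
  proof -
    have "S \<subseteq> {x \<in> N. h x \<in> P}" using S(2) P(2) by auto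
    then have "N \<subseteq> {x \<in> N. h x \<in> P}"
      by (rule S(3)[OF linear_vimage_submodule[OF assms(2) h(2) hc P(1)]])
    then show ?thesis using h(1) by auto
  qed
  then show ?thesis
    unfolding finitely_generated_def using S(1,2) h(1) by (intro exI[of _ "h ` S"]) auto
qed

text \<open>Zorn's lemma on \<open>F\<close>: the union of a nonempty chain is a submodule, its
  finitely many generators already lie in one member of the chain, so the union is that member and
  belongs to \<open>F\<close>.\<close>

lemma noetherianI:
  assumes finitely_generated: "\<And>N. submodule N R M \<Longrightarrow> finitely_generated N"
  shows noetherian
  unfolding noetherian_def
proof (intro allI impI)
  fix F assume F: "F \<noteq> {}" "\<forall>N\<in>F. submodule N R M"
  show "\<exists>N\<in>F. \<forall>K\<in>F. N \<subseteq> K \<longrightarrow> K = N"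
  proof (rule subset_Zorn_nonempty[OF F(1)])
    fix C assume C: "C \<noteq> {}" "subset.chain F C"
    then have sub: "\<And>N. N \<in> C \<Longrightarrow> submodule N R M"
      using F(2) unfolding subset_chain_def by blast
    have upper: "\<exists>Q\<in>C. N \<subseteq> Q \<and> P \<subseteq> Q" if NP: "N \<in> C" "P \<in> C" for N P
    proof -
      have "N \<subseteq> P \<or> P \<subseteq> N" using C(2) NP unfolding subset_chain_def by simp
      then show ?thesis using NP by blast
    qed
    have "submodule (\<Union>C) R M"
    proof (rule submoduleI)
      show "\<Union>C \<subseteq> carrier M" using submoduleD(1)[OF sub] by blast
      show "\<zero>\<^bsub>M\<^esub> \<in> \<Union>C" using C(1) submoduleD(2)[OF sub] by blast
    next
      fix x y assume "x \<in> \<Union>C" "y \<in> \<Union>C"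
      then obtain N P where NP: "N \<in> C" "x \<in> N" "P \<in> C" "y \<in> P" by blast
      then obtain Q where "Q \<in> C" "x \<in> Q" "y \<in> Q" using upper[of N P] by blast
      then show "x \<oplus>\<^bsub>M\<^esub> y \<in> \<Union>C" using submoduleD(3)[OF sub[of Q], of x y] by blast
    next
      fix a x assume "a \<in> carrier R" "x \<in> \<Union>C"
      then obtain Q where "Q \<in> C" "x \<in> Q" "a \<in> carrier R" by blast
      then show "a \<odot>\<^bsub>M\<^esub> x \<in> \<Union>C" using submoduleD(4)[OF sub[of Q], of a x] by blast
    qed
    then obtain S where S: "finite S" "S \<subseteq> \<Union>C"
        "\<And>P. submodule P R M \<Longrightarrow> S \<subseteq> P \<Longrightarrow> \<Union>C \<subseteq> P"
      using finitely_generated[of "\<Union>C"] unfolding finitely_generated_def by blast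
    have "\<exists>Q\<in>C. S \<subseteq> Q"
      using S(1,2)
    proof (induction S)
      case empty
      then show ?case using C(1) by blast
    next
      case (insert s S)
      then obtain Q where Q: "Q \<in> C" "S \<subseteq> Q" by auto
      obtain Q' where Q': "Q' \<in> C" "s \<in> Q'" using insert.prems by auto
      obtain P where "P \<in> C" "Q \<subseteq> P" "Q' \<subseteq> P" using upper[OF Q(1) Q'(1)] by blast
      then show ?case using Q Q' by blast
    qed
    then obtain Q where "Q \<in> C" "S \<subseteq> Q" by blast
    then have "\<Union>C = Q" using S(3)[OF sub, of Q] by auto
    then show "\<Union>C \<in> F" using \<open>Q \<in> C\<close> C(2) unfolding subset_chain_def by auto
  qed
qed

lemma noetherian_maximal:
  assumes noetherian "N0 \<in> F" "\<And>N. N \<in> F \<Longrightarrow> submodule N R M"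
  shows "\<exists>N\<in>F. \<forall>K\<in>F. N \<subseteq> K \<longrightarrow> K = N"
proof -
  have "F \<noteq> {}" "\<forall>N\<in>F. submodule N R M" using assms(2,3) by auto
  then show ?thesis
    using assms(1)[unfolded noetherian_def, THEN spec, of F] by simp
qed

section \<open>Virtually simple and uniform submodules\<close>

definition vsimple :: "'c set \<Rightarrow> bool"
  where "vsimple N \<longleftrightarrow> N \<noteq> {\<zero>\<^bsub>M\<^esub>} \<and>
    (\<forall>P. submodule P R M \<longrightarrow> P \<subseteq> N \<longrightarrow> P \<noteq> {\<zero>\<^bsub>M\<^esub>} \<longrightarrow> isomorphic P N)"

lemma virtually_simple_iff_vsimple:
  assumes "submodule N R M"
  shows "virtually_simple R (M\<lparr>carrier := N\<rparr>) \<longleftrightarrow> vsimple N"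
  using assms module_isomorphic_iff[of _ N]
  unfolding virtually_simple_def vsimple_def by (auto simp: submodule_of_submodule)

definition vsemisimple :: "'c set \<Rightarrow> bool"
  where "vsemisimple N \<longleftrightarrow> (\<forall>P. submodule P R M \<longrightarrow> P \<subseteq> N \<longrightarrow>
    (\<exists>K L. submodule K R M \<and> submodule L R M \<and> K <+>\<^bsub>M\<^esub> L = N \<and> K \<inter> L = {\<zero>\<^bsub>M\<^esub>} \<and> isomorphic P K))"

lemma virtually_semisimple_imp_vsemisimple:
  assumes "submodule N R M" "virtually_semisimple R (M\<lparr>carrier := N\<rparr>)"
  shows "vsemisimple N"
  unfolding vsemisimple_def
proof (intro allI impI)
  fix P assume "submodule P R M" "P \<subseteq> N"
  then obtain K where K: "direct_summand R (M\<lparr>carrier := N\<rparr>) K"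
      "module_isomorphic R (M\<lparr>carrier := P\<rparr>) (M\<lparr>carrier := K\<rparr>)"
    using assms(2) unfolding virtually_semisimple_def
    by (auto simp: submodule_of_submodule[OF assms(1)])
  then show "\<exists>K L. submodule K R M \<and> submodule L R M \<and> K <+>\<^bsub>M\<^esub> L = N \<and>
      K \<inter> L = {\<zero>\<^bsub>M\<^esub>} \<and> isomorphic P K"
    unfolding direct_summand_def
    by (auto simp: submodule_of_submodule[OF assms(1)] sum_carrier_update module_isomorphic_iff)
qed

text \<open>The zero submodule satisfies this vacuously; nonvanishing is stated separately where it
  matters.\<close>

definition uniform :: "'c set \<Rightarrow> bool"
  where "uniform U \<longleftrightarrow> (\<forall>A B. submodule A R M \<longrightarrow> submodule B R M \<longrightarrow> A \<subseteq> U \<longrightarrow> B \<subseteq> U \<longrightarrow>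
    A \<noteq> {\<zero>\<^bsub>M\<^esub>} \<longrightarrow> B \<noteq> {\<zero>\<^bsub>M\<^esub>} \<longrightarrow> A \<inter> B \<noteq> {\<zero>\<^bsub>M\<^esub>})"

text \<open>Take \<open>A\<close> maximal among the submodules of \<open>V\<close> that miss some
  nonzero submodule \<open>B\<close> of \<open>V\<close>. Then \<open>B\<close> is uniform: if
  nonzero \<open>C\<close> and \<open>D\<close> inside \<open>B\<close> were disjoint, A + C would
  still miss \<open>D\<close>, so maximality would put \<open>C\<close> inside \<open>A\<close>,
  which misses \<open>B\<close>.\<close>

lemma uniform_submodule_exists:
  assumes noetherian "submodule V R M" "V \<noteq> {\<zero>\<^bsub>M\<^esub>}"
  shows "\<exists>B. submodule B R M \<and> B \<subseteq> V \<and> B \<noteq> {\<zero>\<^bsub>M\<^esub>} \<and> uniform B"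
proof -
  define F where "F = {A. submodule A R M \<and> A \<subseteq> V \<and>
    (\<exists>B. submodule B R M \<and> B \<subseteq> V \<and> B \<noteq> {\<zero>\<^bsub>M\<^esub>} \<and> A \<inter> B = {\<zero>\<^bsub>M\<^esub>})}"
  \<comment> \<open>The zero submodule misses \<open>V\<close> itself, so \<open>F\<close> is
    nonempty.\<close>
  have "{\<zero>\<^bsub>M\<^esub>} \<inter> V = {\<zero>\<^bsub>M\<^esub>}" "{\<zero>\<^bsub>M\<^esub>} \<subseteq> V" using submoduleD(2)[OF assms(2)] by auto
  then have zero: "{\<zero>\<^bsub>M\<^esub>} \<in> F"
    unfolding F_def using submodule_zero assms(2,3) by blast
  have "\<exists>A\<in>F. \<forall>K\<in>F. A \<subseteq> K \<longrightarrow> K = A"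
    by (rule noetherian_maximal[OF assms(1) zero]) (simp add: F_def)
  then obtain A where A: "A \<in> F" and max: "\<And>K. K \<in> F \<Longrightarrow> A \<subseteq> K \<Longrightarrow> K = A"
    by blast
  then obtain B where B: "submodule A R M" "A \<subseteq> V" "submodule B R M" "B \<subseteq> V" "B \<noteq> {\<zero>\<^bsub>M\<^esub>}"
      "A \<inter> B = {\<zero>\<^bsub>M\<^esub>}"
    unfolding F_def by blast
  have "uniform B"
    unfolding uniform_def
  proof (intro allI impI notI)
    fix C D assume CD: "submodule C R M" "submodule D R M" "C \<subseteq> B" "D \<subseteq> B"
      "C \<noteq> {\<zero>\<^bsub>M\<^esub>}" "D \<noteq> {\<zero>\<^bsub>M\<^esub>}" "C \<inter> D = {\<zero>\<^bsub>M\<^esub>}"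
    have "A \<inter> (C <+>\<^bsub>M\<^esub> D) = {\<zero>\<^bsub>M\<^esub>}"
      using B(6) sum_subset[OF B(3) CD(3,4)] submoduleD(2)[OF B(1)]
        submoduleD(2)[OF submodule_sum[OF CD(1,2)]] by blast
    then have disj: "(A <+>\<^bsub>M\<^esub> C) \<inter> D = {\<zero>\<^bsub>M\<^esub>}"
      by (rule disjoint_sum[OF B(1) CD(1,2) _ CD(7)])
    have "C \<subseteq> V" "D \<subseteq> V" using CD(3,4) B(4) by auto
    then have "A <+>\<^bsub>M\<^esub> C \<in> F"
      unfolding F_def
      using submodule_sum[OF B(1) CD(1)] sum_subset[OF assms(2) B(2), of C] CD(2,6) disj by auto
    then have "A <+>\<^bsub>M\<^esub> C = A"
      using subset_sum_left[OF B(1) CD(1)] by (rule max)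
    then have "C \<subseteq> {\<zero>\<^bsub>M\<^esub>}" using subset_sum_right[OF B(1) CD(1)] CD(3) B(6) by auto
    then show False using CD(5) submoduleD(2)[OF CD(1)] by auto
  qed
  then show ?thesis using B by blast
qed

text \<open>Uniformity is pulled back along an isomorphism \<open>h\<close> from \<open>V\<close>
  onto a uniform submodule \<open>U\<close>: by injectivity, disjoint nonzero submodules of
  \<open>V\<close> would have disjoint nonzero images in \<open>U\<close>.\<close>

lemma vsimple_imp_uniform:
  assumes noetherian "submodule V R M" "vsimple V"
  shows "uniform V"
proof -
  obtain U where U: "submodule U R M" "U \<subseteq> V" "U \<noteq> {\<zero>\<^bsub>M\<^esub>}" "uniform U"
    using uniform_submodule_exists[OF assms(1,2)] assms(3) unfolding vsimple_def by auto
  then have "isomorphic V U"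
    using assms(3) U isomorphic_sym[OF U(1), of V] unfolding vsimple_def by simp
  then obtain h where h: "h ` V = U" "inj_on h V" "linear V h"
    unfolding isomorphic_def bij_betw_def by blast
  have hc: "h \<in> V \<rightarrow> carrier M" using h(1) submoduleD(1)[OF U(1)] by blast
  have img: "submodule (h ` A) R M \<and> h ` A \<noteq> {\<zero>\<^bsub>M\<^esub>}"
    if A: "submodule A R M" "A \<subseteq> V" "A \<noteq> {\<zero>\<^bsub>M\<^esub>}" for A
  proof -
    have "embedding h A U"
      unfolding embedding_def using A(2) h(1) linear_subset[OF h(3) A(2)] inj_on_subset[OF h(2) A(2)]
      by auto
    then show ?thesis
      using embedding_image[OF A(1) U(1), of h] isomorphic_zero_iff[OF A(1), of "h ` A"] A(3) by simp
  qed
  show ?thesis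
    unfolding uniform_def
  proof (intro allI impI notI)
    fix A B assume AB: "submodule A R M" "submodule B R M" "A \<subseteq> V" "B \<subseteq> V"
      "A \<noteq> {\<zero>\<^bsub>M\<^esub>}" "B \<noteq> {\<zero>\<^bsub>M\<^esub>}" "A \<inter> B = {\<zero>\<^bsub>M\<^esub>}"
    have "h ` A \<inter> h ` B = h ` (A \<inter> B)"
      using inj_on_image_Int[OF h(2) AB(3,4)] by simp
    also have "\<dots> = {\<zero>\<^bsub>M\<^esub>}"
      using AB(7) linear_zero[OF assms(2) h(3) hc] by simp
    finally have "h ` A \<inter> h ` B = {\<zero>\<^bsub>M\<^esub>}" .
    moreover have "h ` A \<subseteq> U" "h ` B \<subseteq> U" using h(1) AB by auto
    ultimately show False
      using U(4)[unfolded uniform_def, THEN spec, THEN spec, of "h ` A" "h ` B"]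
        img[OF AB(1,3,5)] img[OF AB(2,4,6)] by simp
  qed
qed

text \<open>A complement \<open>C\<close> of a maximal proper summand \<open>D\<close> of
  \<open>K\<close> is indecomposable. A nonzero submodule \<open>P\<close> of \<open>C\<close> is
  isomorphic to a summand \<open>Q\<close> of C = Q + L; then D + L is again a proper summand of
  \<open>K\<close>, so maximality forces L = 0 and \<open>P\<close> is isomorphic to Q = C.\<close>

lemma vsimple_summand_exists:
  assumes noetherian and vsemisimple: "\<And>C. submodule C R M \<Longrightarrow> vsemisimple C"
    and K: "submodule K R M" "K \<noteq> {\<zero>\<^bsub>M\<^esub>}"
  shows "\<exists>C D. submodule C R M \<and> submodule D R M \<and> C <+>\<^bsub>M\<^esub> D = K \<and> C \<inter> D = {\<zero>\<^bsub>M\<^esub>} \<and> vsimple C"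
proof -
  define F where "F = {D. submodule D R M \<and> D \<noteq> K \<and>
    (\<exists>C. submodule C R M \<and> C <+>\<^bsub>M\<^esub> D = K \<and> C \<inter> D = {\<zero>\<^bsub>M\<^esub>})}"
  have "{\<zero>\<^bsub>M\<^esub>} \<in> F"
    unfolding F_def using submodule_zero K sum_zero_right[OF K(1)] submoduleD(2)[OF K(1)] by auto
  then have "\<exists>D\<in>F. \<forall>X\<in>F. D \<subseteq> X \<longrightarrow> X = D"
    by (rule noetherian_maximal[OF assms(1)]) (simp add: F_def)
  then obtain D where D: "D \<in> F" and max: "\<And>X. X \<in> F \<Longrightarrow> D \<subseteq> X \<Longrightarrow> X = D"
    by blast
  then obtain C where C: "submodule D R M" "D \<noteq> K" "submodule C R M" "C <+>\<^bsub>M\<^esub> D = K" "C \<inter> D = {\<zero>\<^bsub>M\<^esub>}"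
    unfolding F_def by blast
  have "C \<noteq> {\<zero>\<^bsub>M\<^esub>}"
    using C sum_comm[OF C(1) C(3)] sum_zero_right[OF C(1)] by auto
  moreover have "isomorphic P C" if P: "submodule P R M" "P \<subseteq> C" "P \<noteq> {\<zero>\<^bsub>M\<^esub>}" for P
  proof -
    obtain Q L where Q: "submodule Q R M" "submodule L R M" "Q <+>\<^bsub>M\<^esub> L = C" "Q \<inter> L = {\<zero>\<^bsub>M\<^esub>}" "isomorphic P Q"
      using vsemisimple[OF C(3)] P unfolding vsemisimple_def by blast
    have Qnz: "Q \<noteq> {\<zero>\<^bsub>M\<^esub>}" using isomorphic_zero_iff[OF P(1) Q(1,5)] P(3) by simp
    have LQ: "L <+>\<^bsub>M\<^esub> Q = C" using sum_comm[OF Q(1,2)] Q(3) by simp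
    have DL: "submodule (D <+>\<^bsub>M\<^esub> L) R M" by (rule submodule_sum[OF C(1) Q(2)])
    have disj: "(D <+>\<^bsub>M\<^esub> L) \<inter> Q = {\<zero>\<^bsub>M\<^esub>}"
      using disjoint_sum[OF C(1) Q(2,1)] LQ C(5) Q(4) by (simp add: Int_commute)
    have QDL: "Q <+>\<^bsub>M\<^esub> (D <+>\<^bsub>M\<^esub> L) = K"
      using sum_assoc[OF C(1) Q(2,1)] LQ sum_comm[OF DL Q(1)] sum_comm[OF C(1,3)] C(4) by simp
    have "Q \<subseteq> K" using subset_sum_left[OF Q(1) DL] QDL by simp
    \<comment> \<open>The nonzero complement \<open>Q\<close> keeps D + L proper.\<close>
    then have "D <+>\<^bsub>M\<^esub> L \<noteq> K" using disj Qnz by auto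
    then have "D <+>\<^bsub>M\<^esub> L \<in> F"
      unfolding F_def using DL Q(1) QDL disj by (auto simp: Int_commute)
    then have "D <+>\<^bsub>M\<^esub> L = D" using subset_sum_left[OF C(1) Q(2)] by (rule max)
    \<comment> \<open>\<open>L\<close> lies in \<open>D\<close> by maximality and in
      \<open>C\<close> as a summand of it, while C \<inter> D = 0.\<close>
    then have "L \<subseteq> {\<zero>\<^bsub>M\<^esub>}"
      using subset_sum_right[OF C(1) Q(2)] subset_sum_right[OF Q(1,2)] Q(3) C(5) by auto
    then have "L = {\<zero>\<^bsub>M\<^esub>}" using submoduleD(2)[OF Q(2)] by auto
    then have "Q = C" using Q(3) sum_zero_right[OF Q(1)] by simp
    then show ?thesis using Q(5) by simp
  qed
  ultimately have "vsimple C" unfolding vsimple_def by blast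
  then show ?thesis using C by blast
qed

lemma noetherian_if_vsemisimple:
  assumes "finitely_generated (carrier M)" "vsemisimple (carrier M)"
  shows noetherian
proof (rule noetherianI)
  fix N assume N: "submodule N R M"
  then obtain K L where K: "submodule K R M" "submodule L R M" "K <+>\<^bsub>M\<^esub> L = carrier M"
      "K \<inter> L = {\<zero>\<^bsub>M\<^esub>}" "isomorphic N K"
    using assms(2) submoduleD(1)[OF N] unfolding vsemisimple_def by blast
  have "finitely_generated K" by (rule finitely_generated_complemented[OF assms(1) K(1-4)])
  then show "finitely_generated N" by (rule finitely_generated_isomorphic[OF _ K(1) N isomorphic_sym[OF N K(5)]])
qed

section \<open>Independent families\<close>

text \<open>Meant for finite \<open>I\<close>: over an infinite index set \<open>finsum\<close> is
  zero by convention, and for submodules the condition would force every \<open>V i\<close> to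
  vanish.\<close>

definition independent :: "'i set \<Rightarrow> ('i \<Rightarrow> 'c set) \<Rightarrow> bool"
  where "independent I V \<longleftrightarrow> (\<forall>f\<in>Pi I V. finsum M f I = \<zero>\<^bsub>M\<^esub> \<longrightarrow> (\<forall>i\<in>I. f i = \<zero>\<^bsub>M\<^esub>))"

definition family_sum :: "'i set \<Rightarrow> ('i \<Rightarrow> 'c set) \<Rightarrow> 'c set"
  where "family_sum I V = (\<lambda>f. finsum M f I) ` Pi I V"

lemma Pi_submodules_carrier:
  assumes "\<And>i. i \<in> I \<Longrightarrow> submodule (V i) R M" "f \<in> Pi I V"
  shows "f \<in> I \<rightarrow> carrier M"
  using assms submoduleD(6)[OF assms(1)] by blast

lemma finsum_update_insert:
  assumes "finite I" "i \<notin> I" "f \<in> I \<rightarrow> carrier M" "x \<in> carrier M"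
  shows "finsum M (f(i := x)) (insert i I) = x \<oplus>\<^bsub>M\<^esub> finsum M f I"
proof -
  have "finsum M (f(i := x)) I = finsum M f I"
    using assms by (intro M.finsum_cong') auto
  moreover have "f(i := x) \<in> I \<rightarrow> carrier M" using assms by auto
  ultimately show ?thesis
    using M.finsum_insert[of I i "f(i := x)"] assms by simp
qed

lemma finsum_in_submodule:
  assumes "submodule N R M" "finite I" "f \<in> I \<rightarrow> N"
  shows "finsum M f I \<in> N"
  using assms(2,3)
proof (induction I)
  case empty
  then show ?case using submoduleD(2)[OF assms(1)] by simp
next
  case (insert i I)
  then have "f \<in> I \<rightarrow> carrier M" "f i \<in> carrier M"
    using submoduleD(6)[OF assms(1)] by auto
  then show ?case
    using insert submoduleD(3)[OF assms(1)] M.finsum_insert[of I i f] by auto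
qed

lemma family_sum_insert:
  assumes "finite I" "i \<notin> I" and V: "\<And>k. k \<in> insert i I \<Longrightarrow> submodule (V k) R M"
  shows "family_sum (insert i I) V = V i <+>\<^bsub>M\<^esub> family_sum I V"
proof
  show "family_sum (insert i I) V \<subseteq> V i <+>\<^bsub>M\<^esub> family_sum I V"
  proof
    fix x assume "x \<in> family_sum (insert i I) V"
    then obtain f where f: "f \<in> Pi (insert i I) V" "x = finsum M f (insert i I)"
      unfolding family_sum_def by blast
    have c: "f \<in> insert i I \<rightarrow> carrier M" by (rule Pi_submodules_carrier[OF V f(1)])
    then have "x = f i \<oplus>\<^bsub>M\<^esub> finsum M f I"
      using f(2) M.finsum_insert[OF assms(1,2), of f] by auto
    moreover have "f i \<in> V i" "finsum M f I \<in> family_sum I V"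
      using f(1) unfolding family_sum_def by auto
    ultimately show "x \<in> V i <+>\<^bsub>M\<^esub> family_sum I V" using in_sumI by simp
  qed
  show "V i <+>\<^bsub>M\<^esub> family_sum I V \<subseteq> family_sum (insert i I) V"
  proof
    fix y assume "y \<in> V i <+>\<^bsub>M\<^esub> family_sum I V"
    then obtain x z where xz: "x \<in> V i" "z \<in> family_sum I V" "y = x \<oplus>\<^bsub>M\<^esub> z" by (rule in_sumE)
    then obtain f where f: "f \<in> Pi I V" "z = finsum M f I" unfolding family_sum_def by blast
    have c: "f \<in> I \<rightarrow> carrier M" by (rule Pi_submodules_carrier[OF V f(1)]) auto
    have "y = finsum M (f(i := x)) (insert i I)"
      using finsum_update_insert[OF assms(1,2) c] submoduleD(6)[OF V xz(1)] xz(3) f(2) by simp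
    moreover have "f(i := x) \<in> Pi (insert i I) V" using f(1) xz(1) by auto
    ultimately show "y \<in> family_sum (insert i I) V" unfolding family_sum_def by blast
  qed
qed

lemma family_sum_empty: "family_sum {} V = {\<zero>\<^bsub>M\<^esub>}"
  unfolding family_sum_def by auto

lemma submodule_family_sum:
  assumes "finite I" "\<And>i. i \<in> I \<Longrightarrow> submodule (V i) R M"
  shows "submodule (family_sum I V) R M"
  using assms
proof (induction I)
  case empty
  then show ?case using submodule_zero family_sum_empty[of V] by simp
next
  case (insert i I)
  then show ?case using family_sum_insert[of I i V] submodule_sum[of "V i" "family_sum I V"] by simp
qed

lemma subset_family_sum:
  assumes "finite I" "i \<in> I" and V: "\<And>k. k \<in> I \<Longrightarrow> submodule (V k) R M"
  shows "V i \<subseteq> family_sum I V"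
proof -
  have "family_sum (insert i (I - {i})) V = V i <+>\<^bsub>M\<^esub> family_sum (I - {i}) V"
    using assms by (intro family_sum_insert) auto
  moreover have "V i \<subseteq> V i <+>\<^bsub>M\<^esub> family_sum (I - {i}) V"
    using assms by (intro subset_sum_left submodule_family_sum) auto
  ultimately show ?thesis using insert_Diff[OF assms(2)] by simp
qed

lemma independent_empty: "independent {} V"
  unfolding independent_def by simp

text \<open>Reduces independence to direct sums of two submodules, which is what makes induction on
  the index set possible.\<close>

lemma independent_insert:
  assumes "finite I" "i \<notin> I" and V: "\<And>k. k \<in> insert i I \<Longrightarrow> submodule (V k) R M"
  shows "independent (insert i I) V \<longleftrightarrow> independent I V \<and> V i \<inter> family_sum I V = {\<zero>\<^bsub>M\<^esub>}"
proof -
  have Vi: "submodule (V i) R M" using V by simp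
  have D: "submodule (family_sum I V) R M" using submodule_family_sum[OF assms(1)] V by simp
  show ?thesis
  proof (intro iffI conjI)
    assume independent: "independent (insert i I) V"
    \<comment> \<open>Extends a family on \<open>I\<close> by the value \<open>x\<close> at
      \<open>i\<close>. With x = 0 this yields independence over \<open>I\<close>; with a family
      summing to -x it yields the trivial intersection.\<close>
    have upd: "x = \<zero>\<^bsub>M\<^esub> \<and> (\<forall>k\<in>I. f k = \<zero>\<^bsub>M\<^esub>)"
      if x: "x \<in> V i" and f: "f \<in> Pi I V" and eq: "x \<oplus>\<^bsub>M\<^esub> finsum M f I = \<zero>\<^bsub>M\<^esub>" for x f
    proof -
      have c: "f \<in> I \<rightarrow> carrier M" by (rule Pi_submodules_carrier[OF V f]) auto
      have "finsum M (f(i := x)) (insert i I) = \<zero>\<^bsub>M\<^esub>"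
        using finsum_update_insert[OF assms(1,2) c] submoduleD(6)[OF Vi x] eq by simp
      moreover have "f(i := x) \<in> Pi (insert i I) V" using f x by auto
      ultimately have "\<forall>k\<in>insert i I. (f(i := x)) k = \<zero>\<^bsub>M\<^esub>"
        using independent unfolding independent_def by blast
      then show ?thesis using assms(2) by (auto split: if_splits)
    qed
    show "independent I V"
      unfolding independent_def
    proof (intro ballI impI)
      fix f k assume "f \<in> Pi I V" "finsum M f I = \<zero>\<^bsub>M\<^esub>" "k \<in> I"
      then show "f k = \<zero>\<^bsub>M\<^esub>" using upd[OF submoduleD(2)[OF Vi], of f] by simp
    qed
    show "V i \<inter> family_sum I V = {\<zero>\<^bsub>M\<^esub>}"
    proof (rule disjointI[OF Vi D])
      fix x assume x: "x \<in> V i" "x \<in> family_sum I V"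
      then have "\<ominus>\<^bsub>M\<^esub> x \<in> family_sum I V" using submoduleD(5)[OF D] by simp
      then obtain f where f: "f \<in> Pi I V" "\<ominus>\<^bsub>M\<^esub> x = finsum M f I" unfolding family_sum_def by blast
      have "x \<oplus>\<^bsub>M\<^esub> finsum M f I = \<zero>\<^bsub>M\<^esub>"
        using f(2)[symmetric] submoduleD(6)[OF Vi x(1)] M.r_neg by simp
      then show "x = \<zero>\<^bsub>M\<^esub>" using upd[OF x(1) f(1)] by simp
    qed
  next
    assume *: "independent I V \<and> V i \<inter> family_sum I V = {\<zero>\<^bsub>M\<^esub>}"
    show "independent (insert i I) V"
      unfolding independent_def
    proof (intro ballI impI)
      fix f k assume f: "f \<in> Pi (insert i I) V" "finsum M f (insert i I) = \<zero>\<^bsub>M\<^esub>"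
        and k: "k \<in> insert i I"
      have c: "f \<in> insert i I \<rightarrow> carrier M" by (rule Pi_submodules_carrier[OF V f(1)])
      have fI: "f \<in> Pi I V" "f i \<in> V i" using f(1) by auto
      then have fD: "finsum M f I \<in> family_sum I V" unfolding family_sum_def by blast
      have "f i \<oplus>\<^bsub>M\<^esub> finsum M f I = \<zero>\<^bsub>M\<^esub> \<oplus>\<^bsub>M\<^esub> \<zero>\<^bsub>M\<^esub>"
        using f(2) c M.finsum_insert[OF assms(1,2), of f] by auto
      then have "f i = \<zero>\<^bsub>M\<^esub>" "finsum M f I = \<zero>\<^bsub>M\<^esub>"
        using disjoint_unique[OF Vi D conjunct2[OF *] fI(2) fD submoduleD(2)[OF Vi] submoduleD(2)[OF D]]
        by simp_all
      then show "f k = \<zero>\<^bsub>M\<^esub>"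
        using * fI(1) k unfolding independent_def by blast
    qed
  qed
qed

lemma independent_mono:
  assumes "independent I V" "\<And>i. i \<in> I \<Longrightarrow> W i \<subseteq> V i"
  shows "independent I W"
  unfolding independent_def
proof (intro ballI impI)
  fix f i assume f: "f \<in> Pi I W" "finsum M f I = \<zero>\<^bsub>M\<^esub>" "i \<in> I"
  have "f \<in> Pi I V" using f(1) assms(2) by blast
  then show "f i = \<zero>\<^bsub>M\<^esub>" using assms(1) f(2,3) unfolding independent_def by blast
qed

lemma independent_cong: "(\<And>i. i \<in> I \<Longrightarrow> V i = W i) \<Longrightarrow> independent I V = independent I W"
  unfolding independent_def by (auto simp: Pi_def)

lemma family_sum_cong: "(\<And>i. i \<in> I \<Longrightarrow> V i = W i) \<Longrightarrow> family_sum I V = family_sum I W"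
  unfolding family_sum_def by (rule image_cong) (auto simp: Pi_def)

section \<open>Internal direct sums in terms of independent families\<close>

lemma finsum_support:
  assumes "finite I" "f \<in> I \<rightarrow> carrier M"
  shows "finsum M f {i \<in> I. f i \<noteq> \<zero>\<^bsub>M\<^esub>} = finsum M f I"
  using assms by (intro M.add.finprod_mono_neutral_cong_left) auto

lemma internal_direct_sumI:
  assumes "finite I" and V: "\<And>i. i \<in> I \<Longrightarrow> submodule (V i) R M"
    and independent: "independent I V" and sum: "family_sum I V = carrier M"
  shows "internal_direct_sum R M I V"
  unfolding internal_direct_sum_def
proof (intro conjI ballI V ex_ex1I)
  fix x assume "x \<in> carrier M"
  then obtain f where f: "f \<in> Pi I V" "x = finsum M f I" using sum unfolding family_sum_def by blast
  \<comment> \<open>\<open>internal_direct_sum\<close> demands families that are extensional outside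
    \<open>I\<close>, so \<open>f\<close> is cut down to \<open>I\<close>; the sum does not
    change.\<close>
  define g where "g = restrict f I"
  have g: "g \<in> (\<Pi>\<^sub>E i\<in>I. V i)" using f(1) unfolding g_def by auto
  then have c: "g \<in> I \<rightarrow> carrier M" by (intro Pi_submodules_carrier[of I V] V) auto
  have "finsum M f I = finsum M g I"
    using c unfolding g_def by (intro M.finsum_cong') auto
  then show "\<exists>f. f \<in> (\<Pi>\<^sub>E i\<in>I. V i) \<and> finite {i \<in> I. f i \<noteq> \<zero>\<^bsub>M\<^esub>} \<and>
      x = (\<Oplus>\<^bsub>M\<^esub>i\<in>{i \<in> I. f i \<noteq> \<zero>\<^bsub>M\<^esub>}. f i)"
    using g f(2) finsum_support[OF assms(1) c] assms(1) by auto
next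
  fix x f g
  assume f: "f \<in> (\<Pi>\<^sub>E i\<in>I. V i) \<and> finite {i \<in> I. f i \<noteq> \<zero>\<^bsub>M\<^esub>} \<and>
      x = (\<Oplus>\<^bsub>M\<^esub>i\<in>{i \<in> I. f i \<noteq> \<zero>\<^bsub>M\<^esub>}. f i)"
    and g: "g \<in> (\<Pi>\<^sub>E i\<in>I. V i) \<and> finite {i \<in> I. g i \<noteq> \<zero>\<^bsub>M\<^esub>} \<and>
      x = (\<Oplus>\<^bsub>M\<^esub>i\<in>{i \<in> I. g i \<noteq> \<zero>\<^bsub>M\<^esub>}. g i)"
  have c: "f \<in> I \<rightarrow> carrier M" "g \<in> I \<rightarrow> carrier M"
    using f g Pi_submodules_carrier[OF V, of I "\<lambda>i. i" f] Pi_submodules_carrier[OF V, of I "\<lambda>i. i" g]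
    by (auto simp: PiE_def)
  \<comment> \<open>The difference of two representations of \<open>x\<close> is a family that sums
    to zero, so independence makes it vanish on \<open>I\<close>; extensionality then gives f =
    g.\<close>
  define d where "d = (\<lambda>i. f i \<oplus>\<^bsub>M\<^esub> (\<ominus>\<^bsub>M\<^esub> g i))"
  have dV: "d \<in> Pi I V"
    unfolding d_def using f g submoduleD(3,5)[OF V] by (auto simp: PiE_def Pi_def)
  have dc: "d \<in> I \<rightarrow> carrier M" by (rule Pi_submodules_carrier[OF V dV])
  have fi: "d i \<oplus>\<^bsub>M\<^esub> g i = f i" if "i \<in> I" for i
  proof -
    have "f i \<in> carrier M" "g i \<in> carrier M" using c that by auto
    then show ?thesis unfolding d_def by (simp add: M.a_assoc M.l_neg)
  qed
  have "finsum M d I \<oplus>\<^bsub>M\<^esub> finsum M g I = finsum M (\<lambda>i. d i \<oplus>\<^bsub>M\<^esub> g i) I"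
    using dc c by (simp add: M.finsum_addf)
  also have "\<dots> = finsum M f I"
    using c fi by (intro M.finsum_cong') auto
  also have "\<dots> = finsum M g I"
    using f g finsum_support[OF assms(1) c(1)] finsum_support[OF assms(1) c(2)] by simp
  finally have "finsum M d I = \<zero>\<^bsub>M\<^esub>"
    using c dc M.add.r_cancel_one[of "finsum M g I" "finsum M d I"] by simp
  then have "d i = \<zero>\<^bsub>M\<^esub>" if "i \<in> I" for i
    using independent dV that unfolding independent_def by blast
  then have "f i = g i" if "i \<in> I" for i
    using fi[OF that] funcset_mem[OF c(2) that] that by simp
  then show "f = g"
    using f g by (intro PiE_ext[of f I V g]) auto
qed

text \<open>Independence is stated for finite subsets \<open>J\<close> of a possibly infinite
  \<open>I\<close>; this later bounds the number of summands. A relation over \<open>J\<close>,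
  extended by zero, and the zero family both represent the zero element, so uniqueness identifies
  them.\<close>

lemma internal_direct_sumD:
  assumes sum: "internal_direct_sum R M I V"
  shows "i \<in> I \<Longrightarrow> submodule (V i) R M"
    and "finite J \<Longrightarrow> J \<subseteq> I \<Longrightarrow> independent J V"
    and "finite I \<Longrightarrow> family_sum I V = carrier M"
proof -
  show V: "submodule (V i) R M" if "i \<in> I" for i
    using sum that unfolding internal_direct_sum_def by simp
  note rep = sum[unfolded internal_direct_sum_def, THEN conjunct2, THEN bspec]
  show "independent J V" if J: "finite J" "J \<subseteq> I"
    unfolding independent_def
  proof (intro ballI impI)
    fix f j assume f: "f \<in> Pi J V" "finsum M f J = \<zero>\<^bsub>M\<^esub>" and j: "j \<in> J"
    have VJ: "submodule (V k) R M" if "k \<in> J" for k using V J(2) that by auto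
    have c: "f \<in> J \<rightarrow> carrier M" by (rule Pi_submodules_carrier[OF VJ f(1)])
    define g where "g = restrict (\<lambda>i. if i \<in> J then f i else \<zero>\<^bsub>M\<^esub>) I"
    define z where "z = restrict (\<lambda>i. \<zero>\<^bsub>M\<^esub>) I"
    have supp: "{i \<in> I. g i \<noteq> \<zero>\<^bsub>M\<^esub>} = {i \<in> J. f i \<noteq> \<zero>\<^bsub>M\<^esub>}" "{i \<in> I. z i \<noteq> \<zero>\<^bsub>M\<^esub>} = {}"
      unfolding g_def z_def using J(2) by auto
    have "finsum M g {i \<in> J. f i \<noteq> \<zero>\<^bsub>M\<^esub>} = finsum M f {i \<in> J. f i \<noteq> \<zero>\<^bsub>M\<^esub>}"
      unfolding g_def using J(2) c by (intro M.finsum_cong') auto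
    then have gs: "finsum M g {i \<in> I. g i \<noteq> \<zero>\<^bsub>M\<^esub>} = \<zero>\<^bsub>M\<^esub>"
      using f(2) finsum_support[OF J(1) c] supp by simp
    have gV: "g \<in> (\<Pi>\<^sub>E i\<in>I. V i)" "z \<in> (\<Pi>\<^sub>E i\<in>I. V i)"
      unfolding g_def z_def using f(1) submoduleD(2)[OF V] by auto
    have fin: "finite {i \<in> J. f i \<noteq> \<zero>\<^bsub>M\<^esub>}" using J(1) by simp
    have "\<exists>!f. f \<in> (\<Pi>\<^sub>E i\<in>I. V i) \<and> finite {i \<in> I. f i \<noteq> \<zero>\<^bsub>M\<^esub>} \<and>
        \<zero>\<^bsub>M\<^esub> = finsum M f {i \<in> I. f i \<noteq> \<zero>\<^bsub>M\<^esub>}"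
      using rep[OF M.zero_closed] .
    moreover have "g \<in> (\<Pi>\<^sub>E i\<in>I. V i) \<and> finite {i \<in> I. g i \<noteq> \<zero>\<^bsub>M\<^esub>} \<and>
        \<zero>\<^bsub>M\<^esub> = finsum M g {i \<in> I. g i \<noteq> \<zero>\<^bsub>M\<^esub>}"
      unfolding gs unfolding supp(1) using gV(1) fin by simp
    moreover have "z \<in> (\<Pi>\<^sub>E i\<in>I. V i) \<and> finite {i \<in> I. z i \<noteq> \<zero>\<^bsub>M\<^esub>} \<and>
        \<zero>\<^bsub>M\<^esub> = finsum M z {i \<in> I. z i \<noteq> \<zero>\<^bsub>M\<^esub>}"
      unfolding supp(2) using gV(2) by simp
    ultimately have "g = z" by (metis (lifting))
    then have "g j = z j" by simp
    then show "f j = \<zero>\<^bsub>M\<^esub>"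
      unfolding g_def z_def using j J(2) by auto
  qed
  show "family_sum I V = carrier M" if I: "finite I"
  proof
    show "family_sum I V \<subseteq> carrier M" by (rule submoduleD(1)[OF submodule_family_sum[OF I V]])
    show "carrier M \<subseteq> family_sum I V"
    proof
      fix x assume "x \<in> carrier M"
      then obtain f where f: "f \<in> (\<Pi>\<^sub>E i\<in>I. V i)" "x = finsum M f {i \<in> I. f i \<noteq> \<zero>\<^bsub>M\<^esub>}"
        using rep[of x] by auto
      then have fV: "f \<in> Pi I V" by auto
      have "x = finsum M f I"
        using f(2) finsum_support[OF I Pi_submodules_carrier[OF V fV]] by simp
      then show "x \<in> family_sum I V" unfolding family_sum_def using fV by blast
    qed
  qed
qed

section \<open>Existence of a finite decomposition into virtually simple submodules\<close>

definition decomposable :: "'c set \<Rightarrow> bool"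
  where "decomposable N \<longleftrightarrow> (\<exists>(n::nat) V. (\<forall>i<n. submodule (V i) R M \<and> vsimple (V i)) \<and>
    independent {..<n} V \<and> family_sum {..<n} V = N)"

lemma decomposable_sum:
  assumes "decomposable N" "submodule C R M" "vsimple C" "C \<inter> N = {\<zero>\<^bsub>M\<^esub>}"
  shows "decomposable (C <+>\<^bsub>M\<^esub> N)"
proof -
  obtain n :: nat and V where V: "\<forall>i<n. submodule (V i) R M \<and> vsimple (V i)"
      "independent {..<n} V" "family_sum {..<n} V = N"
    using assms(1) unfolding decomposable_def by blast
  define V' where "V' = V(n := C)"
  have V': "\<forall>i<Suc n. submodule (V' i) R M \<and> vsimple (V' i)"
    unfolding V'_def using V(1) assms(2,3) by (auto simp: less_Suc_eq)
  have independent: "independent {..<n} V'" using V(2) independent_cong[of "{..<n}" V V'] unfolding V'_def by simp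
  have sum: "family_sum {..<n} V' = N" using V(3) family_sum_cong[of "{..<n}" V V'] unfolding V'_def by simp
  have eq: "{..<Suc n} = insert n {..<n}" by auto
  have sub: "submodule (V' k) R M" if "k \<in> insert n {..<n}" for k
    using V' that by auto
  have "independent {..<Suc n} V'"
    using independent_insert[of "{..<n}" n V', OF _ _ sub] independent sum assms(4) unfolding eq
    by (simp add: V'_def)
  moreover have "family_sum {..<Suc n} V' = C <+>\<^bsub>M\<^esub> N"
    using family_sum_insert[of "{..<n}" n V', OF _ _ sub] sum unfolding eq by (simp add: V'_def)
  ultimately show ?thesis unfolding decomposable_def using V' by blast
qed

text \<open>Take a decomposable summand \<open>N\<close> of \<open>M\<close> that is maximal, with
  complement \<open>K\<close>. If \<open>K\<close> were nonzero, it would split off a virtually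
  simple \<open>C\<close>, and N + C would be a larger decomposable summand.\<close>

lemma decomposable_carrier:
  assumes noetherian and vsemisimple: "\<And>C. submodule C R M \<Longrightarrow> vsemisimple C"
  shows "decomposable (carrier M)"
proof -
  define F where "F = {N. submodule N R M \<and> decomposable N \<and>
    (\<exists>K. submodule K R M \<and> N <+>\<^bsub>M\<^esub> K = carrier M \<and> N \<inter> K = {\<zero>\<^bsub>M\<^esub>})}"
  \<comment> \<open>The empty sum, with n = 0, starts the maximality argument and also covers the
    zero module.\<close>
  have "decomposable {\<zero>\<^bsub>M\<^esub>}"
    unfolding decomposable_def by (rule exI[of _ 0]) (simp add: independent_empty family_sum_empty)
  moreover have "{\<zero>\<^bsub>M\<^esub>} <+>\<^bsub>M\<^esub> carrier M = carrier M"
    using sum_comm[OF submodule_zero submodule_carrier] sum_zero_right[OF submodule_carrier] by simp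
  ultimately have "{\<zero>\<^bsub>M\<^esub>} \<in> F"
    unfolding F_def using submodule_zero submodule_carrier by auto
  then have "\<exists>N\<in>F. \<forall>X\<in>F. N \<subseteq> X \<longrightarrow> X = N"
    by (rule noetherian_maximal[OF assms(1)]) (simp add: F_def)
  then obtain N where N: "N \<in> F" and max: "\<And>X. X \<in> F \<Longrightarrow> N \<subseteq> X \<Longrightarrow> X = N"
    by blast
  then obtain K where K: "submodule N R M" "decomposable N" "submodule K R M"
      "N <+>\<^bsub>M\<^esub> K = carrier M" "N \<inter> K = {\<zero>\<^bsub>M\<^esub>}"
    unfolding F_def by blast
  have "K = {\<zero>\<^bsub>M\<^esub>}"
  proof (rule ccontr)
    assume "K \<noteq> {\<zero>\<^bsub>M\<^esub>}"
    then obtain C D where C: "submodule C R M" "submodule D R M" "C <+>\<^bsub>M\<^esub> D = K"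
        "C \<inter> D = {\<zero>\<^bsub>M\<^esub>}" "vsimple C"
      using vsimple_summand_exists[OF assms K(3)] by blast
    have CK: "C \<subseteq> K" using subset_sum_left[OF C(1,2)] C(3) by simp
    have CN: "C \<inter> N = {\<zero>\<^bsub>M\<^esub>}"
      using CK K(5) submoduleD(2)[OF C(1)] by auto
    have "decomposable (N <+>\<^bsub>M\<^esub> C)"
      using decomposable_sum[OF K(2) C(1,5) CN] sum_comm[OF C(1) K(1)] by simp
    moreover have "(N <+>\<^bsub>M\<^esub> C) <+>\<^bsub>M\<^esub> D = carrier M"
      using sum_assoc[OF K(1) C(1,2)] C(3) K(4) by simp
    moreover have "(N <+>\<^bsub>M\<^esub> C) \<inter> D = {\<zero>\<^bsub>M\<^esub>}"
      using disjoint_sum[OF K(1) C(1,2) _ C(4)] C(3) K(5) by simp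
    ultimately have "N <+>\<^bsub>M\<^esub> C \<in> F"
      unfolding F_def using submodule_sum[OF K(1) C(1)] C(2) by blast
    then have "N <+>\<^bsub>M\<^esub> C = N" using subset_sum_left[OF K(1) C(1)] by (rule max)
    then have "C \<subseteq> N" using subset_sum_right[OF K(1) C(1)] by simp
    then have "C = {\<zero>\<^bsub>M\<^esub>}" using CN by auto
    then show False using C(5) unfolding vsimple_def by simp
  qed
  then show ?thesis using K(2,4) sum_zero_right[OF K(1)] by simp
qed

section \<open>Embeddings and projections along a complement\<close>

lemma embedding_comp:
  assumes "embedding h A B" "embedding g B C"
  shows "embedding (g \<circ> h) A C"
proof -
  have h: "h \<in> A \<rightarrow> B" "inj_on h A" "linear A h" and g: "g \<in> B \<rightarrow> C" "inj_on g B" "linear B g"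
    using assms unfolding embedding_def by auto
  have "h ` A \<subseteq> B" using h(1) by auto
  then have "inj_on (g \<circ> h) A" by (rule comp_inj_on[OF h(2) inj_on_subset[OF g(2)]])
  then show ?thesis
    unfolding embedding_def using linear_comp[OF h(3,1) g(3)] h(1) g(1) by auto
qed

lemma embedding_subset:
  assumes "A \<subseteq> B"
  shows "embedding (\<lambda>x. x) A B"
  using assms unfolding embedding_def linear_def by auto

text \<open>The projection of U + L onto \<open>U\<close> along \<open>L\<close> has kernel
  \<open>L\<close>, so on \<open>X\<close> its kernel is X \<inter> L = 0.\<close>

lemma projection_embedding:
  assumes X: "submodule X R M" and U: "submodule U R M" and L: "submodule L R M"
    and XUL: "X \<subseteq> U <+>\<^bsub>M\<^esub> L" and XL: "X \<inter> L = {\<zero>\<^bsub>M\<^esub>}" and UL: "U \<inter> L = {\<zero>\<^bsub>M\<^esub>}"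
  obtains p where "embedding p X U"
proof -
  have "\<exists>u. u \<in> U \<and> (\<exists>l\<in>L. x = u \<oplus>\<^bsub>M\<^esub> l)" if "x \<in> X" for x
  proof -
    have "x \<in> U <+>\<^bsub>M\<^esub> L" using XUL that by auto
    then show ?thesis by (rule in_sumE) blast
  qed
  then obtain p where p: "\<And>x. x \<in> X \<Longrightarrow> p x \<in> U \<and> (\<exists>l\<in>L. x = p x \<oplus>\<^bsub>M\<^esub> l)" by metis
  \<comment> \<open>So far \<open>p\<close> is a mere choice of components; by directness it agrees
    with the \<open>U\<close>-component of any decomposition, and linearity follows by decomposing
    sums and multiples componentwise.\<close>
  have uniq: "p x = u" if ul: "x \<in> X" "u \<in> U" "l \<in> L" "x = u \<oplus>\<^bsub>M\<^esub> l" for x u l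
  proof -
    obtain l' where l': "l' \<in> L" "x = p x \<oplus>\<^bsub>M\<^esub> l'" using p[OF ul(1)] by blast
    show ?thesis
      using disjoint_unique(1)[OF U L UL conjunct1[OF p[OF ul(1)]] l'(1) ul(2,3)] l'(2) ul(4)
      by simp
  qed
  note c = submoduleD(6)[OF U] submoduleD(6)[OF L]
  have "inj_on p X"
  proof (rule inj_onI)
    fix x y assume x: "x \<in> X" and y: "y \<in> X" and eq: "p x = p y"
    obtain l where l: "l \<in> L" "x = p x \<oplus>\<^bsub>M\<^esub> l" using p[OF x] by blast
    obtain l' where l': "l' \<in> L" "y = p y \<oplus>\<^bsub>M\<^esub> l'" using p[OF y] by blast
    have px: "p x \<in> carrier M" using p[OF x] c(1) by blast
    \<comment> \<open>Equal \<open>U\<close>-components give x + l' = y + l with l and l' in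
      \<open>L\<close>; directness of \<open>X\<close> and \<open>L\<close> then yields x =
      y.\<close>
    have "x \<oplus>\<^bsub>M\<^esub> l' = p x \<oplus>\<^bsub>M\<^esub> l \<oplus>\<^bsub>M\<^esub> l'" using l(2) by simp
    also have "\<dots> = p y \<oplus>\<^bsub>M\<^esub> l' \<oplus>\<^bsub>M\<^esub> l"
      using px l(1) l'(1) c(2) eq by (simp add: M.a_ac)
    also have "\<dots> = y \<oplus>\<^bsub>M\<^esub> l" using l'(2) by simp
    finally show "x = y"
      by (rule disjoint_unique(1)[OF X L XL x l'(1) y l(1)])
  qed
  moreover have "linear X p"
    unfolding linear_def
  proof (intro conjI ballI)
    fix x y assume x: "x \<in> X" and y: "y \<in> X"
    obtain l where l: "l \<in> L" "x = p x \<oplus>\<^bsub>M\<^esub> l" using p[OF x] by blast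
    obtain l' where l': "l' \<in> L" "y = p y \<oplus>\<^bsub>M\<^esub> l'" using p[OF y] by blast
    have px: "p x \<in> U" "p y \<in> U" using p x y by auto
    have "x \<oplus>\<^bsub>M\<^esub> y = (p x \<oplus>\<^bsub>M\<^esub> l) \<oplus>\<^bsub>M\<^esub> (p y \<oplus>\<^bsub>M\<^esub> l')" using l(2) l'(2) by simp
    also have "\<dots> = (p x \<oplus>\<^bsub>M\<^esub> p y) \<oplus>\<^bsub>M\<^esub> (l \<oplus>\<^bsub>M\<^esub> l')"
      using px l(1) l'(1) c by (simp add: M.a_ac)
    finally show "p (x \<oplus>\<^bsub>M\<^esub> y) = p x \<oplus>\<^bsub>M\<^esub> p y"
      by (rule uniq[OF submoduleD(3)[OF X x y] submoduleD(3)[OF U px] submoduleD(3)[OF L l(1) l'(1)]])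
  next
    fix a x assume a: "a \<in> carrier R" and x: "x \<in> X"
    obtain l where l: "l \<in> L" "x = p x \<oplus>\<^bsub>M\<^esub> l" using p[OF x] by blast
    have px: "p x \<in> U" using p x by auto
    have "a \<odot>\<^bsub>M\<^esub> x = a \<odot>\<^bsub>M\<^esub> (p x \<oplus>\<^bsub>M\<^esub> l)" using l(2) by simp
    also have "\<dots> = a \<odot>\<^bsub>M\<^esub> p x \<oplus>\<^bsub>M\<^esub> a \<odot>\<^bsub>M\<^esub> l"
      using px l(1) c a by (simp add: smult_r_distr)
    finally show "p (a \<odot>\<^bsub>M\<^esub> x) = a \<odot>\<^bsub>M\<^esub> p x"
      by (rule uniq[OF submoduleD(4)[OF X a x] submoduleD(4)[OF U a px] submoduleD(4)[OF L a l(1)]])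
  qed
  ultimately have "embedding p X U" unfolding embedding_def using p by auto
  then show thesis by (rule that)
qed

section \<open>Exchange for uniform submodules\<close>

text \<open>For nonzero uniform \<open>A\<close> and \<open>B\<close> this amounts to having
  isomorphic injective hulls. The common submodule \<open>N\<close> may lie anywhere in
  \<open>M\<close>; only its embedded copies lie in \<open>A\<close> and \<open>B\<close>.\<close>

definition share_submodule :: "'c set \<Rightarrow> 'c set \<Rightarrow> bool"
  where "share_submodule A B \<longleftrightarrow> (\<exists>N g h. submodule N R M \<and> N \<noteq> {\<zero>\<^bsub>M\<^esub>} \<and> embedding g N A \<and> embedding h N B)"

lemma share_submodule_embedding:
  assumes "share_submodule A B" "embedding q A A'"
  shows "share_submodule A' B"
  using assms embedding_comp[of _ _ A q A'] unfolding share_submodule_def by blast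

lemma embedding_imp_share_submodule:
  assumes "embedding h A B" "submodule A R M" "A \<noteq> {\<zero>\<^bsub>M\<^esub>}"
  shows "share_submodule A B"
  using assms embedding_subset[of A A] unfolding share_submodule_def by blast

text \<open>The copy of \<open>N\<close> inside a virtually simple module is nonzero, hence
  isomorphic to the whole module; so \<open>A\<close> and \<open>B\<close> are both isomorphic to
  \<open>N\<close>.\<close>

lemma vsimple_share_submodule_imp_isomorphic:
  assumes "submodule A R M" "submodule B R M" "vsimple A" "vsimple B" "share_submodule A B"
  shows "isomorphic A B"
proof -
  obtain N g h where N: "submodule N R M" "N \<noteq> {\<zero>\<^bsub>M\<^esub>}" "embedding g N A" "embedding h N B"
    using assms(5) unfolding share_submodule_def by blast
  have iso: "isomorphic N X" if X: "submodule X R M" "vsimple X" "embedding e N X" for e X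
  proof -
    note im = embedding_image[OF N(1) X(1,3)]
    have "e ` N \<noteq> {\<zero>\<^bsub>M\<^esub>}" using isomorphic_zero_iff[OF N(1) im(1,3)] N(2) by simp
    then have "isomorphic (e ` N) X" using X(2) im(1,2) unfolding vsimple_def by simp
    with im(3) show ?thesis by (rule isomorphic_trans)
  qed
  show ?thesis
    using iso[OF assms(1,3) N(3)] iso[OF assms(2,4) N(4)] isomorphic_sym[OF N(1)] isomorphic_trans by blast
qed

text \<open>For \<open>U \<inter> L = 0\<close> this is the image of \<open>X \<inter> (U + L)\<close> under the projection onto \<open>U\<close> along \<open>L\<close>.\<close>

definition proj :: "'c set \<Rightarrow> 'c set \<Rightarrow> 'c set \<Rightarrow> 'c set"
  where "proj U L X = {u \<in> U. \<exists>l\<in>L. u \<oplus>\<^bsub>M\<^esub> l \<in> X}"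

lemma submodule_proj:
  assumes U: "submodule U R M" and L: "submodule L R M" and X: "submodule X R M"
  shows "submodule (proj U L X) R M"
proof (rule submoduleI)
  note c = submoduleD(6)[OF U] submoduleD(6)[OF L]
  show "proj U L X \<subseteq> carrier M" unfolding proj_def using c(1) by auto
  have "\<zero>\<^bsub>M\<^esub> \<oplus>\<^bsub>M\<^esub> \<zero>\<^bsub>M\<^esub> \<in> X" using submoduleD(2)[OF X] by simp
  then show "\<zero>\<^bsub>M\<^esub> \<in> proj U L X"
    unfolding proj_def using submoduleD(2)[OF U] submoduleD(2)[OF L] by blast
  fix x y assume "x \<in> proj U L X" "y \<in> proj U L X"
  then obtain l l' where x: "x \<in> U" "l \<in> L" "x \<oplus>\<^bsub>M\<^esub> l \<in> X" and y: "y \<in> U" "l' \<in> L" "y \<oplus>\<^bsub>M\<^esub> l' \<in> X"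
    unfolding proj_def by blast
  have "(x \<oplus>\<^bsub>M\<^esub> y) \<oplus>\<^bsub>M\<^esub> (l \<oplus>\<^bsub>M\<^esub> l') = (x \<oplus>\<^bsub>M\<^esub> l) \<oplus>\<^bsub>M\<^esub> (y \<oplus>\<^bsub>M\<^esub> l')"
    using x y c by (simp add: M.a_ac)
  then have "(x \<oplus>\<^bsub>M\<^esub> y) \<oplus>\<^bsub>M\<^esub> (l \<oplus>\<^bsub>M\<^esub> l') \<in> X"
    using submoduleD(3)[OF X x(3) y(3)] by simp
  then show "x \<oplus>\<^bsub>M\<^esub> y \<in> proj U L X"
    unfolding proj_def using submoduleD(3)[OF U x(1) y(1)] submoduleD(3)[OF L x(2) y(2)] by blast
next
  note c = submoduleD(6)[OF U] submoduleD(6)[OF L]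
  fix a x assume a: "a \<in> carrier R" and "x \<in> proj U L X"
  then obtain l where x: "x \<in> U" "l \<in> L" "x \<oplus>\<^bsub>M\<^esub> l \<in> X" unfolding proj_def by blast
  have "a \<odot>\<^bsub>M\<^esub> x \<oplus>\<^bsub>M\<^esub> a \<odot>\<^bsub>M\<^esub> l \<in> X"
    using submoduleD(4)[OF X a x(3)] a x c by (simp add: smult_r_distr)
  then show "a \<odot>\<^bsub>M\<^esub> x \<in> proj U L X"
    unfolding proj_def using submoduleD(4)[OF U a x(1)] submoduleD(4)[OF L a x(2)] by blast
qed

text \<open>Every element of \<open>X\<close> has a \<open>U\<close>-component in
  \<open>proj U L X\<close>; when that component is zero, only the component in \<open>L\<close>
  remains.\<close>

lemma proj_zero_imp_subset:
  assumes U: "submodule U R M" and L: "submodule L R M" and X: "submodule X R M"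
    and XUL: "X \<subseteq> U <+>\<^bsub>M\<^esub> L"
  shows "proj U L X = {\<zero>\<^bsub>M\<^esub>} \<Longrightarrow> X \<subseteq> L"
proof
  fix x assume 0: "proj U L X = {\<zero>\<^bsub>M\<^esub>}" and x: "x \<in> X"
  have "x \<in> U <+>\<^bsub>M\<^esub> L" using XUL x by auto
  then obtain u l where ul: "u \<in> U" "l \<in> L" "x = u \<oplus>\<^bsub>M\<^esub> l" by (rule in_sumE)
  then have "u \<in> proj U L X" unfolding proj_def using x by auto
  then show "x \<in> L" using 0 ul submoduleD(6)[OF L ul(2)] by simp
qed

text \<open>If \<open>X\<close> has zero image in \<open>U\<close>, it lies in \<open>L\<close> and
  hence in \<open>proj L W X\<close>. Otherwise \<open>X\<close> and \<open>W\<close> both have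
  nonzero images in \<open>U\<close>, and uniformity provides a nonzero v common to both. With v + l
  in \<open>W\<close> and v + l' in \<open>X\<close>, the difference l' - l is a nonzero element of
  \<open>proj L W X\<close>.\<close>

lemma proj_nonzero:
  assumes U: "submodule U R M" "uniform U" and L: "submodule L R M" and UL: "U \<inter> L = {\<zero>\<^bsub>M\<^esub>}"
    and W: "submodule W R M" "W \<noteq> {\<zero>\<^bsub>M\<^esub>}" "W \<subseteq> U <+>\<^bsub>M\<^esub> L" "W \<inter> L = {\<zero>\<^bsub>M\<^esub>}"
    and X: "submodule X R M" "X \<noteq> {\<zero>\<^bsub>M\<^esub>}" "X \<subseteq> U <+>\<^bsub>M\<^esub> L" "X \<inter> W = {\<zero>\<^bsub>M\<^esub>}"
  shows "proj L W X \<noteq> {\<zero>\<^bsub>M\<^esub>}"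
proof (cases "proj U L X = {\<zero>\<^bsub>M\<^esub>}")
  case True
  then have XL: "X \<subseteq> L" by (rule proj_zero_imp_subset[OF U(1) L X(1,3)])
  have "X \<subseteq> proj L W X"
  proof
    fix x assume x: "x \<in> X"
    then have "x \<oplus>\<^bsub>M\<^esub> \<zero>\<^bsub>M\<^esub> \<in> X" using submoduleD(6)[OF X(1)] by simp
    then show "x \<in> proj L W X"
      unfolding proj_def using x XL submoduleD(2)[OF W(1)] by blast
  qed
  then show ?thesis using X(2) submoduleD(2)[OF X(1)] by auto
next
  case False
  note c = submoduleD(6)[OF U(1)] submoduleD(6)[OF L] submoduleD(6)[OF W(1)]
  have "proj U L W \<noteq> {\<zero>\<^bsub>M\<^esub>}"
  proof
    assume "proj U L W = {\<zero>\<^bsub>M\<^esub>}"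
    then have "W \<subseteq> L" by (rule proj_zero_imp_subset[OF U(1) L W(1,3)])
    then show False using W(2,4) by auto
  qed
  moreover have "proj U L W \<subseteq> U" "proj U L X \<subseteq> U" unfolding proj_def by auto
  ultimately have "proj U L W \<inter> proj U L X \<noteq> {\<zero>\<^bsub>M\<^esub>}"
    using False submodule_proj[OF U(1) L W(1)] submodule_proj[OF U(1) L X(1)]
      U(2)[unfolded uniform_def, THEN spec, THEN spec, of "proj U L W" "proj U L X"] by simp
  then obtain v where v: "v \<in> proj U L W \<inter> proj U L X" "v \<noteq> \<zero>\<^bsub>M\<^esub>"
    by (rule submodule_nonzeroE[OF submodule_Int[OF submodule_proj[OF U(1) L W(1)]
        submodule_proj[OF U(1) L X(1)]]])
  then obtain l l' where l: "v \<in> U" "l \<in> L" "v \<oplus>\<^bsub>M\<^esub> l \<in> W" "l' \<in> L" "v \<oplus>\<^bsub>M\<^esub> l' \<in> X"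
    unfolding proj_def by blast
  define y where "y = l' \<oplus>\<^bsub>M\<^esub> (\<ominus>\<^bsub>M\<^esub> l)"
  have y: "y \<in> L" unfolding y_def using submoduleD(3)[OF L l(4) submoduleD(5)[OF L l(2)]] .
  have yl: "y \<oplus>\<^bsub>M\<^esub> l = l'"
    unfolding y_def using l c by (simp add: M.a_assoc M.l_neg)
  \<comment> \<open>Adding the element v + l of \<open>W\<close> carries y to the element v + l' of
    \<open>X\<close>.\<close>
  have "y \<oplus>\<^bsub>M\<^esub> (v \<oplus>\<^bsub>M\<^esub> l) = v \<oplus>\<^bsub>M\<^esub> (y \<oplus>\<^bsub>M\<^esub> l)"
    using y l c by (simp add: M.a_ac)
  then have "y \<oplus>\<^bsub>M\<^esub> (v \<oplus>\<^bsub>M\<^esub> l) \<in> X" using l(5) yl by simp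
  then have yp: "y \<in> proj L W X" unfolding proj_def using y l(3) by blast
  \<comment> \<open>If y = 0, then v + l lies in X \<inter> W = 0, and directness of
    \<open>U\<close> and \<open>L\<close> gives v = 0.\<close>
  have "y \<noteq> \<zero>\<^bsub>M\<^esub>"
  proof
    assume "y = \<zero>\<^bsub>M\<^esub>"
    then have "l' = l" using yl c(2)[OF l(2)] by simp
    then have "v \<oplus>\<^bsub>M\<^esub> l \<in> X \<inter> W" using l by simp
    then have "v \<oplus>\<^bsub>M\<^esub> l = \<zero>\<^bsub>M\<^esub> \<oplus>\<^bsub>M\<^esub> \<zero>\<^bsub>M\<^esub>" using X(4) by simp
    then have "v = \<zero>\<^bsub>M\<^esub>"
      by (rule disjoint_unique(1)[OF U(1) L UL l(1,2) submoduleD(2)[OF U(1)] submoduleD(2)[OF L]])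
    then show False using v(2) by simp
  qed
  then show ?thesis using yp by auto
qed

text \<open>The image embeds back into \<open>X\<close>: it lies in X + W, because y = (y + w) - w,
  and it meets \<open>W\<close> only in zero because \<open>L\<close> does. Hence the projection
  onto \<open>X\<close> along \<open>W\<close> is injective on it.\<close>

lemma proj_embedding:
  assumes L: "submodule L R M" and W: "submodule W R M" and X: "submodule X R M"
    and XW: "X \<inter> W = {\<zero>\<^bsub>M\<^esub>}" and LW: "L \<inter> W = {\<zero>\<^bsub>M\<^esub>}"
  obtains q where "embedding q (proj L W X) X"
proof -
  have "proj L W X \<subseteq> X <+>\<^bsub>M\<^esub> W"
  proof
    fix y assume "y \<in> proj L W X"
    then obtain w where w: "y \<in> L" "w \<in> W" "y \<oplus>\<^bsub>M\<^esub> w \<in> X" unfolding proj_def by blast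
    have "y = (y \<oplus>\<^bsub>M\<^esub> w) \<oplus>\<^bsub>M\<^esub> (\<ominus>\<^bsub>M\<^esub> w)"
      using submoduleD(6)[OF L w(1)] submoduleD(6)[OF W w(2)] by (simp add: M.a_assoc M.r_neg)
    also have "\<dots> \<in> X <+>\<^bsub>M\<^esub> W" by (rule in_sumI[OF w(3) submoduleD(5)[OF W w(2)]])
    finally show "y \<in> X <+>\<^bsub>M\<^esub> W" .
  qed
  moreover have "proj L W X \<inter> W = {\<zero>\<^bsub>M\<^esub>}"
    using LW submoduleD(2)[OF submodule_proj[OF L W X]] submoduleD(2)[OF W]
    unfolding proj_def by blast
  ultimately show thesis
    using projection_embedding[OF submodule_proj[OF L W X] X W _ _ XW] that by blast
qed

text \<open>Lift a relation among the projections by elements w i of \<open>W j\<close> so that f i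
  + w i lies in \<open>W i\<close>. The lifted terms sum to an element of \<open>W j\<close>, so
  independence of the whole family makes each f i + w i zero, and L \<inter> W j = 0 gives f i =
  0.\<close>

lemma independent_proj:
  assumes "finite J" "j \<notin> J" and W: "\<And>k. k \<in> insert j J \<Longrightarrow> submodule (W k) R M"
    and independent: "independent (insert j J) W" and L: "submodule L R M" "L \<inter> W j = {\<zero>\<^bsub>M\<^esub>}"
  shows "independent J (\<lambda>k. proj L (W j) (W k))"
  unfolding independent_def
proof (intro ballI impI)
  fix f k assume f: "f \<in> (\<Pi> k\<in>J. proj L (W j) (W k))" "finsum M f J = \<zero>\<^bsub>M\<^esub>" and k: "k \<in> J"
  have Wj: "submodule (W j) R M" using W by simp
  have indJ: "independent J W" and disj: "W j \<inter> family_sum J W = {\<zero>\<^bsub>M\<^esub>}"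
    using independent independent_insert[OF assms(1,2) W] by simp_all
  have "\<exists>w. w \<in> W j \<and> f i \<oplus>\<^bsub>M\<^esub> w \<in> W i" if "i \<in> J" for i
    using f(1) that unfolding proj_def by auto
  then obtain w where w: "\<And>i. i \<in> J \<Longrightarrow> w i \<in> W j \<and> f i \<oplus>\<^bsub>M\<^esub> w i \<in> W i" by metis
  have fL: "f i \<in> L" if "i \<in> J" for i using f(1) that unfolding proj_def by auto
  have fc: "f \<in> J \<rightarrow> carrier M" using fL submoduleD(6)[OF L(1)] by auto
  have wJ: "w \<in> J \<rightarrow> W j" using w by auto
  then have wc: "w \<in> J \<rightarrow> carrier M" using submoduleD(6)[OF Wj] by auto
  define g where "g = (\<lambda>i. f i \<oplus>\<^bsub>M\<^esub> w i)"
  have g: "g \<in> Pi J W" unfolding g_def using w by auto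
  have "finsum M g J = finsum M f J \<oplus>\<^bsub>M\<^esub> finsum M w J"
    unfolding g_def using fc wc by (rule M.finsum_addf)
  then have gw: "finsum M g J = finsum M w J" using f(2) wc by simp
  have "finsum M g J \<in> W j" unfolding gw by (rule finsum_in_submodule[OF Wj assms(1) wJ])
  moreover have "finsum M g J \<in> family_sum J W" unfolding family_sum_def using g by blast
  ultimately have "finsum M g J \<in> W j \<inter> family_sum J W" by (rule IntI)
  then have "finsum M g J = \<zero>\<^bsub>M\<^esub>" unfolding disj by simp
  then have "g k = \<zero>\<^bsub>M\<^esub>" using indJ g k unfolding independent_def by blast
  then have "f k \<oplus>\<^bsub>M\<^esub> w k = \<zero>\<^bsub>M\<^esub> \<oplus>\<^bsub>M\<^esub> \<zero>\<^bsub>M\<^esub>" unfolding g_def by simp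
  then show "f k = \<zero>\<^bsub>M\<^esub>"
    by (rule disjoint_unique(1)[OF L(1) Wj L(2) fL[OF k] conjunct1[OF w[OF k]]
        submoduleD(2)[OF L(1)] submoduleD(2)[OF Wj]])
qed

text \<open>
  Induction on \<open>I\<close>: when \<open>i\<close> is added to \<open>I\<close>, the sum \<open>L\<close> becomes \<open>V\<^sub>i \<oplus> L\<close>. If every \<open>W\<^sub>j\<close> meets \<open>L\<close>, the
  intersections \<open>W\<^sub>j \<inter> L\<close> are independent in \<open>L\<close>. Otherwise some \<open>W\<^sub>j\<close> embeds in \<open>V\<^sub>i\<close>; it is matched with
  \<open>i\<close>, and the other \<open>W\<^sub>k\<close> are replaced by their projections to \<open>L\<close> along \<open>W\<^sub>j\<close>, which by uniformity
  of \<open>V\<^sub>i\<close> do not vanish on \<open>W\<^sub>k \<inter> (W\<^sub>j + L)\<close>.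
\<close>

lemma uniform_exchange:
  assumes "finite I" "finite J"
    and "\<And>i. i \<in> I \<Longrightarrow> submodule (V i) R M" "\<And>i. i \<in> I \<Longrightarrow> uniform (V i)" "independent I V"
    and "\<And>j. j \<in> J \<Longrightarrow> submodule (W j) R M" "\<And>j. j \<in> J \<Longrightarrow> W j \<noteq> {\<zero>\<^bsub>M\<^esub>}"
    and "\<And>j. j \<in> J \<Longrightarrow> W j \<subseteq> family_sum I V" "independent J W"
  shows "\<exists>\<pi>. inj_on \<pi> J \<and> \<pi> \<in> J \<rightarrow> I \<and> (\<forall>j\<in>J. share_submodule (W j) (V (\<pi> j)))"
  using assms
\<comment> \<open>\<open>J\<close> and \<open>W\<close> are generalised because the induction step
  drops an index and replaces the submodules by intersections with, or projections to, the smaller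
  sum.\<close>
proof (induction I arbitrary: J W)
  case empty
  have "J = {}"
  proof (rule ccontr)
    assume "J \<noteq> {}"
    then obtain j where j: "j \<in> J" by blast
    then have "W j \<subseteq> {\<zero>\<^bsub>M\<^esub>}" using empty.prems(7)[OF j] family_sum_empty[of V] by simp
    then show False using empty.prems(6)[OF j] submoduleD(2)[OF empty.prems(5)[OF j]] by auto
  qed
  then show ?case by simp
next
  case (insert i I)
  note finJ = insert.prems(1) and W = insert.prems(5) and Wnz = insert.prems(6)
  have V: "submodule (V i) R M" "uniform (V i)" "\<And>k. k \<in> I \<Longrightarrow> submodule (V k) R M"
      "\<And>k. k \<in> I \<Longrightarrow> uniform (V k)"
    using insert.prems(2,3) by auto
  define L where "L = family_sum I V"
  have L: "submodule L R M" unfolding L_def by (rule submodule_family_sum[OF insert.hyps(1) V(3)])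
  have indI: "independent I V" and VL: "V i \<inter> L = {\<zero>\<^bsub>M\<^esub>}"
    using independent_insert[OF insert.hyps insert.prems(2)] insert.prems(4) unfolding L_def by simp_all
  have WVL: "W j \<subseteq> V i <+>\<^bsub>M\<^esub> L" if "j \<in> J" for j
    using insert.prems(7)[OF that] family_sum_insert[OF insert.hyps insert.prems(2)] unfolding L_def by simp
  show ?case
  proof (cases "\<forall>j\<in>J. W j \<inter> L \<noteq> {\<zero>\<^bsub>M\<^esub>}")
    case True
    have "\<exists>\<pi>. inj_on \<pi> J \<and> \<pi> \<in> J \<rightarrow> I \<and> (\<forall>j\<in>J. share_submodule (W j \<inter> L) (V (\<pi> j)))"
    proof (rule insert.IH[OF finJ V(3,4) indI])
      show "submodule (W j \<inter> L) R M" if "j \<in> J" for j by (rule submodule_Int[OF W[OF that] L])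
      show "W j \<inter> L \<noteq> {\<zero>\<^bsub>M\<^esub>}" if "j \<in> J" for j using True that by simp
      show "W j \<inter> L \<subseteq> family_sum I V" if "j \<in> J" for j unfolding L_def by simp
      show "independent J (\<lambda>j. W j \<inter> L)" by (rule independent_mono[OF insert.prems(8)]) auto
    qed
    then obtain \<pi> where \<pi>: "inj_on \<pi> J" "\<pi> \<in> J \<rightarrow> I" "\<forall>j\<in>J. share_submodule (W j \<inter> L) (V (\<pi> j))" by blast
    have "share_submodule (W j) (V (\<pi> j))" if "j \<in> J" for j
      using share_submodule_embedding[OF bspec[OF \<pi>(3) that] embedding_subset[OF Int_lower1]] .
    then show ?thesis using \<pi>(1,2) by (intro exI[of _ \<pi>]) auto
  next
    case False
    then obtain j where j: "j \<in> J" "W j \<inter> L = {\<zero>\<^bsub>M\<^esub>}" by blast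
    define J' where "J' = J - {j}"
    have J': "finite J'" "j \<notin> J'" "J = insert j J'" unfolding J'_def using finJ j(1) by auto
    have independent: "independent (insert j J') W" using insert.prems(8) J'(3) by simp
    have W': "submodule (W k) R M" if "k \<in> insert j J'" for k using W that J'(3) by simp
    have LW: "L \<inter> W j = {\<zero>\<^bsub>M\<^esub>}" using j(2) by (simp add: Int_commute)
    have disj: "W k \<inter> W j = {\<zero>\<^bsub>M\<^esub>}" if k: "k \<in> J'" for k
    proof -
      have "W k \<subseteq> family_sum J' W" using J'(1) k by (rule subset_family_sum) (use W' in auto)
      moreover have "W j \<inter> family_sum J' W = {\<zero>\<^bsub>M\<^esub>}" using independent independent_insert[OF J'(1,2) W'] by simp
      ultimately show ?thesis
        using submoduleD(2)[OF W'[of j]] submoduleD(2)[OF W'[of k]] k by auto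
    qed
    define Y where "Y = (\<lambda>k. proj L (W j) (W k))"
    have "\<exists>\<pi>. inj_on \<pi> J' \<and> \<pi> \<in> J' \<rightarrow> I \<and> (\<forall>k\<in>J'. share_submodule (Y k) (V (\<pi> k)))"
    proof (rule insert.IH[OF J'(1) V(3,4) indI])
      fix k assume k: "k \<in> J'"
      then have kJ: "k \<in> J" using J'(3) by simp
      show "submodule (Y k) R M"
        unfolding Y_def by (rule submodule_proj[OF L W[OF j(1)] W[OF kJ]])
      show "Y k \<noteq> {\<zero>\<^bsub>M\<^esub>}"
        unfolding Y_def
        by (rule proj_nonzero[OF V(1,2) L VL W[OF j(1)] Wnz[OF j(1)] WVL[OF j(1)] j(2)
            W[OF kJ] Wnz[OF kJ] WVL[OF kJ] disj[OF k]])
      show "Y k \<subseteq> family_sum I V" unfolding Y_def proj_def L_def by auto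
    next
      show "independent J' Y" unfolding Y_def by (rule independent_proj[OF J'(1,2) W' independent L LW])
    qed
    then obtain \<pi> where \<pi>: "inj_on \<pi> J'" "\<pi> \<in> J' \<rightarrow> I" "\<forall>k\<in>J'. share_submodule (Y k) (V (\<pi> k))" by blast
    have simk: "share_submodule (W k) (V (\<pi> k))" if k: "k \<in> J'" for k
    proof -
      have kJ: "k \<in> J" using J'(3) k by simp
      obtain q where "embedding q (Y k) (W k)"
        unfolding Y_def by (rule proj_embedding[OF L W[OF j(1)] W[OF kJ] disj[OF k] LW])
      then show ?thesis by (rule share_submodule_embedding[OF bspec[OF \<pi>(3) k]])
    qed
    have simj: "share_submodule (W j) (V i)"
    proof -
      obtain p where "embedding p (W j) (V i)"
        by (rule projection_embedding[OF W[OF j(1)] V(1) L WVL[OF j(1)] j(2) VL])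
      then show ?thesis by (rule embedding_imp_share_submodule[OF _ W[OF j(1)] Wnz[OF j(1)]])
    qed
    \<comment> \<open>\<open>\<pi>\<close> takes values in \<open>I\<close>, which does not contain
      \<open>i\<close>, so the extended map is still injective.\<close>
    define \<rho> where "\<rho> = \<pi>(j := i)"
    have "inj_on \<rho> J"
      unfolding \<rho>_def J'(3) using \<pi>(1,2) J'(2) insert.hyps(2) by (auto simp: inj_on_def)
    moreover have "\<rho> \<in> J \<rightarrow> insert i I" unfolding \<rho>_def J'(3) using funcset_mem[OF \<pi>(2)] by simp
    moreover have "share_submodule (W k) (V (\<rho> k))" if "k \<in> J" for k
      unfolding \<rho>_def using simk simj that J'(2,3) by auto
    ultimately show ?thesis by blast
  qed
qed

section \<open>Uniqueness of the virtually simple summands\<close>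

lemma virtually_simple_exchange:
  assumes noetherian "finite I" "finite J"
    and V: "\<And>i. i \<in> I \<Longrightarrow> submodule (V i) R M" "\<And>i. i \<in> I \<Longrightarrow> vsimple (V i)"
      "independent I V" "family_sum I V = carrier M"
    and W: "\<And>j. j \<in> J \<Longrightarrow> submodule (W j) R M" "\<And>j. j \<in> J \<Longrightarrow> vsimple (W j)" "independent J W"
  shows "\<exists>\<pi>. inj_on \<pi> J \<and> \<pi> \<in> J \<rightarrow> I \<and> (\<forall>j\<in>J. isomorphic (W j) (V (\<pi> j)))"
proof -
  have "\<exists>\<pi>. inj_on \<pi> J \<and> \<pi> \<in> J \<rightarrow> I \<and> (\<forall>j\<in>J. share_submodule (W j) (V (\<pi> j)))"
  proof (rule uniform_exchange[OF assms(2,3) V(1) _ V(3) W(1) _ _ W(3)])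
    show "uniform (V i)" if "i \<in> I" for i
      by (rule vsimple_imp_uniform[OF assms(1) V(1)[OF that] V(2)[OF that]])
    show "W j \<noteq> {\<zero>\<^bsub>M\<^esub>}" if "j \<in> J" for j
      using W(2)[OF that] unfolding vsimple_def by simp
    show "W j \<subseteq> family_sum I V" if "j \<in> J" for j
      unfolding V(4) by (rule submoduleD(1)[OF W(1)[OF that]])
  qed
  then obtain \<pi> where \<pi>: "inj_on \<pi> J" "\<pi> \<in> J \<rightarrow> I" "\<forall>j\<in>J. share_submodule (W j) (V (\<pi> j))" by blast
  have "isomorphic (W j) (V (\<pi> j))" if j: "j \<in> J" for j
  proof -
    have i: "\<pi> j \<in> I" using \<pi>(2) j by (rule funcset_mem)
    show ?thesis
      by (rule vsimple_share_submodule_imp_isomorphic[OF W(1)[OF j] V(1)[OF i] W(2)[OF j] V(2)[OF i] bspec[OF \<pi>(3) j]])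
  qed
  then show ?thesis using \<pi>(1,2) by blast
qed

text \<open>Every finite subfamily is independent, so the exchange property injects its index set
  into that of a fixed decomposition with n summands. All finite subsets of \<open>J\<close> thus
  have at most n elements.\<close>

lemma finite_virtually_simple_summands:
  assumes noetherian "decomposable (carrier M)"
    and sum: "internal_direct_sum R M J W" and W: "\<And>j. j \<in> J \<Longrightarrow> vsimple (W j)"
  shows "finite J"
proof -
  obtain n :: nat and V where V: "\<forall>i<n. submodule (V i) R M \<and> vsimple (V i)"
      "independent {..<n} V" "family_sum {..<n} V = carrier M"
    using assms(2) unfolding decomposable_def by blast
  have "card G \<le> n" if G: "G \<subseteq> J" "finite G" for G
  proof -
    have "\<exists>\<pi>. inj_on \<pi> G \<and> \<pi> \<in> G \<rightarrow> {..<n} \<and> (\<forall>j\<in>G. isomorphic (W j) (V (\<pi> j)))"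
      using V internal_direct_sumD(1)[OF sum] internal_direct_sumD(2)[OF sum G(2,1)] W G
      by (intro virtually_simple_exchange[OF assms(1) finite_lessThan G(2)]) auto
    then obtain \<pi> where "inj_on \<pi> G" "\<pi> ` G \<subseteq> {..<n}" by blast
    then show ?thesis using card_inj_on_le[of \<pi> G "{..<n}"] by simp
  qed
  then show ?thesis using finite_if_finite_subsets_card_bdd[of J n] by blast
qed

lemma virtually_simple_summands_unique:
  assumes noetherian "finite I" "finite J"
    and V: "internal_direct_sum R M I V" "\<And>i. i \<in> I \<Longrightarrow> vsimple (V i)"
    and W: "internal_direct_sum R M J W" "\<And>j. j \<in> J \<Longrightarrow> vsimple (W j)"
  shows "\<exists>\<pi>. bij_betw \<pi> I J \<and> (\<forall>i\<in>I. isomorphic (V i) (W (\<pi> i)))"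
proof -
  note VD = internal_direct_sumD(1)[OF V(1)] V(2) internal_direct_sumD(2)[OF V(1) assms(2) order_refl]
    internal_direct_sumD(3)[OF V(1) assms(2)]
  note WD = internal_direct_sumD(1)[OF W(1)] W(2) internal_direct_sumD(2)[OF W(1) assms(3) order_refl]
    internal_direct_sumD(3)[OF W(1) assms(3)]
  obtain \<pi> where \<pi>: "inj_on \<pi> I" "\<pi> \<in> I \<rightarrow> J" "\<forall>i\<in>I. isomorphic (V i) (W (\<pi> i))"
    using virtually_simple_exchange[OF assms(1,3,2) WD VD(1-3)] by blast
  obtain \<rho> where \<rho>: "inj_on \<rho> J" "\<rho> \<in> J \<rightarrow> I"
    using virtually_simple_exchange[OF assms(1,2,3) VD WD(1-3)] by blast
  have "\<pi> ` I \<subseteq> J" "\<rho> ` J \<subseteq> I" using \<pi>(2) \<rho>(2) by auto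
  \<comment> \<open>\<open>\<rho>\<close> serves for counting: \<open>J\<close> has at most as many
    elements as \<open>I\<close>, hence as the image of \<open>\<pi>\<close>, which therefore fills
    \<open>J\<close>.\<close>
  then have "\<pi> ` I = J"
    using card_inj_on_le[OF \<rho>(1) _ assms(2)] card_image[OF \<pi>(1)] card_subset_eq[OF assms(3)]
      card_mono[OF assms(3)] by (metis le_antisym)
  then show ?thesis using \<pi>(1,3) unfolding bij_betw_def by blast
qed

end

theorem proposition3p1:
  fixes R :: "('r, 'z) ring_scheme" and M :: "('r, 'm, 'x) module_scheme"
  assumes "left_module R M"
    and "finitely_generated_module R M"
    and "completely_virtually_semisimple R M"
  shows "(\<exists>(n::nat) V. internal_direct_sum R M {..<n} V \<and>
        (\<forall>i<n. virtually_simple R (M\<lparr>carrier := V i\<rparr>))) \<and>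
    (\<forall>(I::'i set) (J::'j set) V W.
        internal_direct_sum R M I V \<longrightarrow> (\<forall>i\<in>I. virtually_simple R (M\<lparr>carrier := V i\<rparr>)) \<longrightarrow>
        internal_direct_sum R M J W \<longrightarrow> (\<forall>j\<in>J. virtually_simple R (M\<lparr>carrier := W j\<rparr>)) \<longrightarrow>
        (\<exists>\<pi>. bij_betw \<pi> I J \<and>
          (\<forall>i\<in>I. module_isomorphic R (M\<lparr>carrier := V i\<rparr>) (M\<lparr>carrier := W (\<pi> i)\<rparr>))))"
proof -
  interpret left_module R M by (rule assms(1))
  have vsemisimple: "vsemisimple N" if "submodule N R M" for N
    using virtually_semisimple_imp_vsemisimple[OF that] assms(3) that
    unfolding completely_virtually_semisimple_def by blast
  have noeth: noetherian
    by (rule noetherian_if_vsemisimple[OF finitely_generated_module_imp_fg[OF assms(2)] vsemisimple[OF submodule_carrier]])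
  have decomposable: "decomposable (carrier M)" by (rule decomposable_carrier[OF noeth vsemisimple])
  have vsD: "vsimple (X k)" if "internal_direct_sum R M K X"
      "\<forall>k\<in>K. virtually_simple R (M\<lparr>carrier := X k\<rparr>)" "k \<in> K" for K X k
    using virtually_simple_iff_vsimple[OF internal_direct_sumD(1)[OF that(1,3)]] that(2,3) by blast
  have unique: "\<exists>\<pi>. bij_betw \<pi> I J \<and>
      (\<forall>i\<in>I. module_isomorphic R (M\<lparr>carrier := V i\<rparr>) (M\<lparr>carrier := W (\<pi> i)\<rparr>))"
    if V: "internal_direct_sum R M I V" "\<forall>i\<in>I. virtually_simple R (M\<lparr>carrier := V i\<rparr>)"
      and W: "internal_direct_sum R M J W" "\<forall>j\<in>J. virtually_simple R (M\<lparr>carrier := W j\<rparr>)"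
    for I :: "'i set" and J :: "'j set" and V W
  proof -
    \<comment> \<open>The given index sets are arbitrary, so finiteness has to come before the
      comparison of the two decompositions.\<close>
    have fin: "finite I" "finite J"
      using finite_virtually_simple_summands[OF noeth decomposable V(1) vsD[OF V]]
        finite_virtually_simple_summands[OF noeth decomposable W(1) vsD[OF W]] by simp_all
    show ?thesis
      using virtually_simple_summands_unique[OF noeth fin V(1) vsD[OF V] W(1) vsD[OF W]]
      unfolding module_isomorphic_iff by blast
  qed
  obtain n :: nat and V where V: "\<forall>i<n. submodule (V i) R M \<and> vsimple (V i)"
      "independent {..<n} V" "family_sum {..<n} V = carrier M"
    using decomposable unfolding decomposable_def by blast
  have "internal_direct_sum R M {..<n} V"
    using V by (intro internal_direct_sumI) auto
  moreover have "\<forall>i<n. virtually_simple R (M\<lparr>carrier := V i\<rparr>)"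
    using V(1) virtually_simple_iff_vsimple by blast
  ultimately have "\<exists>(n::nat) V. internal_direct_sum R M {..<n} V \<and>
        (\<forall>i<n. virtually_simple R (M\<lparr>carrier := V i\<rparr>))" by blast
  with unique show ?thesis by blast
qed

end
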